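(* Let $P$ be a finite poset whose Hasse diagram $H(P)$ is a tree, and let $h(P)$ be its height. Then, as $n\to\infty$, $$\operatorname{ex}(P,n)=(h(P)-1)\binom{n}{\lfloor n/2\rfloor}\bigl(1+O(1/n)\bigr),$$ where the implied constant may depend on $P$. Moreover, $l(P)=h(P)-1$.
   Context: A poset $P$ is a subposet of a poset $P'$ (equivalently, $P'$ contains $P$) if there is an injective map $f\colon P\to P'$ such that $a\le_P b$ implies $f(a)\le_{P'}f(b)$ (not necessarily induced). The Hasse diagram $H(P)$ is the undirected graph whose vertices are the elements of $P$, where $xy$ is an edge if $x<y$ and there is no $z\in P$ with $x<z<y$. The height $h(P)$ is the length of the longest chain in $P$, where the length of a chain is its number of elements. Let $[n]=\{1,\dots,n\}$ and let $2^{[n]}$ be the collection of all subsets of $[n]$. A family $\mathcal F\subset 2^{[n]}$ is viewed as a poset under inclusion; it is $P$-free if it does not contain $P$ as a subposet. $\operatorname{ex}(P,n)$ denotes the size of the largest $P$-free family $\mathcal F\subset 2^{[n]}$. Let $\operatorname{Mon}(\mathbb Z)$ be the set of all functions $f\colon\mathbb Z\to\{0,1\}$ such that $f(n)=1$ and $f(-n)=0$ for all sufficiently large $n$, ordered by $f\le g$ if $f(n)\le g(n)$ for all $n\in\mathbb Z$. For $f,g\in\operatorname{Mon}(\mathbb Z)$ the sum $\sum_{n\in\mathbb Z}(f(n)-g(n))$ has only finitely many nonzero terms. A level of $\operatorname{Mon}(\mathbb Z)$ is a maximal family $L\subset\operatorname{Mon}(\mathbb Z)$ satisfying $\sum_n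 (f(n)-g(n))=0$ for all $f,g\in L$. For a finite poset $P$, $l(P)$ is the maximum number of (distinct) levels of $\operatorname{Mon}(\mathbb Z)$ whose union (with the induced order) does not contain $P$ as a subposet. *)

theory Defs
  imports
    Complex_Main
    "HOL-Library.Landau_Symbols"
    "HOL-Library.Extended_Nat"
    "HOL-Library.Groups_Big_Fun"
begin

text \<open>
  A poset is a carrier \<open>A\<close> together with a relation \<open>r\<close> satisfying
  \<^term>\<open>partial_order_on A r\<close> (reflexive order, \<open>r \<subseteq> A \<times> A\<close>).
\<close>

definition subposet :: "'a set \<Rightarrow> 'a rel \<Rightarrow> 'b set \<Rightarrow> 'b rel \<Rightarrow> bool" where
  "subposet A r B s \<longleftrightarrow>
     (\<exists>f. inj_on f A \<and> f ` A \<subseteq> B \<and> (\<forall>a\<in>A. \<forall>b\<in>A. (a, b) \<in> r \<longrightarrow> (f a, f b) \<in> s))"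

text \<open>A subset \<open>F\<close> of an ordered type, taken as a poset with the induced order, is \<open>P\<close>-free.\<close>

definition poset_free :: "'a set \<Rightarrow> 'a rel \<Rightarrow> 'b::order set \<Rightarrow> bool" where
  "poset_free A r F \<longleftrightarrow> \<not> subposet A r F (relation_of (\<le>) F)"

definition hasse_edges :: "'a rel \<Rightarrow> 'a set set" where
  "hasse_edges r = {{x, y} | x y. (x, y) \<in> r \<and> x \<noteq> y \<and>
     \<not> (\<exists>z. z \<noteq> x \<and> z \<noteq> y \<and> (x, z) \<in> r \<and> (z, y) \<in> r)}"

text \<open>
  Undirected simple graphs are given by a vertex set and a set of two-element edges; a cycle is the
  cyclic list of its at least three distinct vertices.
\<close>

definition graph_cycle :: "'a set set \<Rightarrow> 'a list \<Rightarrow> bool" where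
  "graph_cycle E c \<longleftrightarrow> 3 \<le> length c \<and> distinct c \<and>
     (\<forall>i < length c. {c ! i, c ! (Suc i mod length c)} \<in> E)"

definition graph_connected :: "'a set \<Rightarrow> 'a set set \<Rightarrow> bool" where
  "graph_connected V E \<longleftrightarrow> V \<noteq> {} \<and> (\<forall>x\<in>V. \<forall>y\<in>V. (x, y) \<in> {(u, v). {u, v} \<in> E}\<^sup>*)"

definition is_tree :: "'a set \<Rightarrow> 'a set set \<Rightarrow> bool" where
  "is_tree V E \<longleftrightarrow> graph_connected V E \<and> \<not> (\<exists>c. graph_cycle E c)"

text \<open>Members of \<^term>\<open>Chains r\<close> lie in the carrier, since \<open>a = b\<close> is allowed in the definition.\<close>

definition height :: "'a rel \<Rightarrow> nat" where
  "height r = Max (card ` Chains r)"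

text \<open>The value is unspecified for the empty poset, which no family avoids.\<close>

definition ex_poset :: "'a set \<Rightarrow> 'a rel \<Rightarrow> nat \<Rightarrow> nat" where
  "ex_poset A r n = Max (card ` {F :: nat set set. F \<subseteq> Pow {1..n} \<and> poset_free A r F})"

definition Mon :: "(int \<Rightarrow> int) set" where
  "Mon = {f. range f \<subseteq> {0, 1} \<and> eventually (\<lambda>n. f n = 1 \<and> f (- n) = 0) at_top}"

definition same_level :: "(int \<Rightarrow> int) set \<Rightarrow> bool" where
  "same_level L \<longleftrightarrow> L \<subseteq> Mon \<and> (\<forall>f\<in>L. \<forall>g\<in>L. Sum_any (\<lambda>n. f n - g n) = 0)"

definition is_level :: "(int \<Rightarrow> int) set \<Rightarrow> bool" where
  "is_level L \<longleftrightarrow> same_level L \<and> (\<forall>L'. same_level L' \<and> L \<subseteq> L' \<longrightarrow> L' = L)"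

text \<open>
  The maximum is a supremum in \<^typ>\<open>enat\<close>, so that it is \<open>\<infinity>\<close>, not an unspecified number, if the
  sizes are unbounded; a finite supremum is attained. Restricting to finite \<open>S\<close> loses nothing
  because subfamilies of \<open>P\<close>-free families are \<open>P\<close>-free.
\<close>

definition max_levels :: "'a set \<Rightarrow> 'a rel \<Rightarrow> enat" where
  "max_levels A r =
     (SUP S \<in> {S. finite S \<and> S \<subseteq> Collect is_level \<and> poset_free A r (\<Union> S)}. enat (card S))"

end

theory Submission
  imports Defs "HOL-Library.Transitive_Closure_Table" "HOL-Combinatorics.Multiset_Permutations"
begin

text \<open>
  Write \<open>k\<close> for the height of the tree poset \<open>P\<close> and \<open>m\<close> for its number of elements. A union of
  \<open>k - 1\<close> antichains has no chain of \<open>k\<close> elements, so it cannot contain \<open>P\<close>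
  (\<open>poset_free_if_few_levels\<close>). Applied to the middle layers of the cube and to \<open>k - 1\<close> levels of
  \<open>Mon\<close>, this gives both lower bounds.

  Both upper bounds come from one greedy embedding (\<open>tree_poset_embeds\<close>). As the Hasse diagram is a
  tree, \<open>P\<close> can be built up one vertex at a time so that each new vertex has exactly one neighbour
  among the earlier ones. Since the order is generated by the Hasse edges, a new vertex \<open>v\<close> with
  neighbour \<open>u\<close> only has to be put on the correct side of the image of \<open>u\<close> and off the finitely many
  points in use. The rank function, which is strictly increasing with values below \<open>k\<close>, tells on
  which of \<open>k\<close> levels \<open>v\<close> is sought. In \<open>Mon\<close> this always succeeds: a sequence has infinitely many
  others below it on each lower level and above it on each higher level.

  In the cube, let \<open>F\<close> be \<open>P\<close>-free. Sets of size at most \<open>n/4\<close> or at least \<open>3n/4\<close> are negligible, so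
  suppose that \<open>F\<close> has none of them. A full chain of the cube meets \<open>F\<close> in at most \<open>m\<close> sets, since
  otherwise \<open>P\<close> would embed in the chain. The average number of members of \<open>F\<close> on a full chain is at
  least the size of \<open>F\<close> divided by the middle binomial coefficient, so it suffices to show that only
  an \<open>O(1/n)\<close> fraction of all full chains are rich, that is, have \<open>k\<close> or more members
  (\<open>card_rich_permutations_le\<close>). Mark \<open>k\<close> members on each rich chain; the \<open>j\<close>-th mark plays the role
  of level \<open>j\<close>. A marked set \<open>Y\<close> can be a dead end of the greedy procedure only if all
  the chains with \<open>j\<close>-th mark \<open>Y\<close> run through one of \<open>m\<close> other sets. Given that a full chain passes
  through \<open>Y\<close>, it passes through a given other proper nonempty set with probability at most \<open>4/n\<close>,
  so deleting the chains with such bottlenecks costs an \<open>O(1/n)\<close> fraction (\<open>card_pruned_le\<close>). If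
  more chains were rich, some would survive \<open>m\<close> successive deletions, and the surviving chains would
  allow an embedding of \<open>P\<close>.
\<close>

section \<open>The rank function of a finite poset\<close>

lemma finite_Chains:
  assumes "finite A" "partial_order_on A r"
  shows "finite (Chains r)" "C \<in> Chains r \<Longrightarrow> C \<subseteq> A" "C \<in> Chains r \<Longrightarrow> finite C"
proof -
  have rA: "r \<subseteq> A \<times> A"
    using assms(2) by (auto simp: partial_order_on_def preorder_on_def refl_on_def)
  show *: "C \<subseteq> A" if "C \<in> Chains r" for C
    using that rA unfolding Chains_def by blast
  show "finite C" if "C \<in> Chains r" for C
    using *[OF that] assms(1) finite_subset by blast
  show "finite (Chains r)"
    by (rule finite_subset[of _ "Pow A"]) (use * assms(1) in auto)
qed

definition chains_below :: "'a rel \<Rightarrow> 'a \<Rightarrow> 'a set set" where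
  "chains_below r x = {C \<in> Chains r. \<forall>c\<in>C. (c, x) \<in> r \<and> c \<noteq> x}"

definition rank :: "'a rel \<Rightarrow> 'a \<Rightarrow> nat" where
  "rank r x = Max (card ` chains_below r x)"

text \<open>
  A longest chain strictly below \<open>x\<close>, completed by \<open>x\<close> itself. It serves both to bound ranks by the
  height and to compare the ranks of \<open>x\<close> and of elements above it.
\<close>

lemma chain_above:
  assumes "finite A" "partial_order_on A r" "x \<in> A"
  obtains C where "x \<in> C" "C \<in> Chains r" "\<forall>c\<in>C. (c, x) \<in> r" "card C = Suc (rank r x)"
proof -
  have fin: "finite (chains_below r x)"
    using finite_Chains(1)[OF assms(1,2)] by (simp add: chains_below_def)
  have "{} \<in> chains_below r x" by (simp add: chains_below_def Chains_def)
  then have "Max (card ` chains_below r x) \<in> card ` chains_below r x"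
    using fin by (intro Max_in) auto
  then obtain D where D: "D \<in> chains_below r x" "card D = rank r x"
    unfolding rank_def by force
  have xx: "(x, x) \<in> r"
    using assms(2,3) by (auto simp: partial_order_on_def preorder_on_def refl_on_def)
  have "finite D" using D(1) finite_Chains(3)[OF assms(1,2)] by (auto simp: chains_below_def)
  moreover have "x \<notin> D" using D(1) by (auto simp: chains_below_def)
  ultimately have "card (insert x D) = Suc (rank r x)" using D(2) by simp
  moreover have "insert x D \<in> Chains r" "\<forall>c\<in>insert x D. (c, x) \<in> r"
    using D(1) xx by (auto simp: chains_below_def Chains_def)
  ultimately show thesis using that by blast
qed

lemma card_chain_le_height:
  assumes "finite A" "partial_order_on A r" "C \<in> Chains r"
  shows "card C \<le> height r"
  unfolding height_def using finite_Chains(1)[OF assms(1,2)] assms(3) by simp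

lemma obtain_longest_chain:
  assumes "finite A" "partial_order_on A r"
  obtains C where "C \<in> Chains r" "card C = height r"
proof -
  have "{} \<in> Chains r" by (simp add: Chains_def)
  then have "Max (card ` Chains r) \<in> card ` Chains r"
    using finite_Chains(1)[OF assms] by (intro Max_in) auto
  with that show thesis unfolding height_def by force
qed

lemma rank_less_height:
  assumes "finite A" "partial_order_on A r" "x \<in> A"
  shows "rank r x < height r"
  using chain_above[OF assms] card_chain_le_height[OF assms(1,2)] by (metis Suc_le_eq)

lemma tree_height_pos:
  assumes "finite A" "partial_order_on A r" "is_tree A (hasse_edges r)"
  shows "0 < height r"
proof -
  obtain x where "x \<in> A" using assms(3) by (auto simp: is_tree_def graph_connected_def)
  then show ?thesis using rank_less_height[OF assms(1,2)] by fastforce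
qed

lemma rank_strict_mono:
  assumes "finite A" "partial_order_on A r" "(x, y) \<in> r" "x \<noteq> y"
  shows "rank r x < rank r y"
proof -
  have po: "trans r" "antisym r" "x \<in> A"
    using assms(2,3) by (auto simp: partial_order_on_def preorder_on_def refl_on_def)
  obtain C where C: "x \<in> C" "C \<in> Chains r" "\<forall>c\<in>C. (c, x) \<in> r" "card C = Suc (rank r x)"
    using chain_above[OF assms(1,2) po(3)] .
  have "C \<in> chains_below r y"
    using C po(1,2) assms(3,4) unfolding chains_below_def by (auto dest: transD antisymD)
  moreover have "finite (chains_below r y)"
    using finite_Chains(1)[OF assms(1,2)] by (simp add: chains_below_def)
  ultimately have "card C \<le> rank r y" unfolding rank_def by simp
  with C(4) show ?thesis by simp
qed

text \<open>
  A finite order is generated by its Hasse edges: a comparable pair that is not an edge has an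
  element in between, and both halves span a smaller difference of ranks.
\<close>

lemma monotone_if_monotone_on_hasse_edges:
  fixes f :: "'a \<Rightarrow> 'b::order"
  assumes "finite A" "partial_order_on A r"
    and edge: "\<And>x y. {x, y} \<in> hasse_edges r \<Longrightarrow> (x, y) \<in> r \<Longrightarrow> f x \<le> f y"
    and "(x, y) \<in> r"
  shows "f x \<le> f y"
  using assms(4)
proof (induction "rank r y - rank r x" arbitrary: x y rule: less_induct)
  case less
  have tr: "trans r" using assms(2) by (auto simp: partial_order_on_def preorder_on_def)
  consider "x = y" | "{x, y} \<in> hasse_edges r"
    | z where "z \<noteq> x" "z \<noteq> y" "(x, z) \<in> r" "(z, y) \<in> r"
    using less.prems unfolding hasse_edges_def by blast
  then show ?case
  proof cases
    case 3
    have "rank r x < rank r z" "rank r z < rank r y"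
      using 3 rank_strict_mono[OF assms(1,2)] by metis+
    then have "f x \<le> f z" "f z \<le> f y"
      using less.hyps[of z x] less.hyps[of y z] 3 by auto
    then show ?thesis by simp
  qed (use edge less.prems in auto)
qed

section \<open>Greedy embedding of tree posets\<close>

text \<open>
  Two neighbours of \<open>v\<close> in a connected set \<open>B\<close> that omits \<open>v\<close> would close a cycle through a simple
  path in \<open>B\<close>.
\<close>

lemma unique_neighbour_in_connected:
  assumes acyclic: "\<not> (\<exists>c. graph_cycle E c)"
    and conn: "(u, u') \<in> {(a, b). a \<in> B \<and> b \<in> B \<and> {a, b} \<in> E}\<^sup>*"
    and "u \<in> B" "v \<notin> B" "{v, u} \<in> E" "{v, u'} \<in> E"
  shows "u' = u"
proof (rule ccontr)
  assume "u' \<noteq> u"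
  define R where "R = (\<lambda>a b. a \<in> B \<and> b \<in> B \<and> {a, b} \<in> E)"
  have "R\<^sup>*\<^sup>* u u'"
    using conn by (simp add: R_def rtranclp_rtrancl_eq[symmetric] rtranclp_def)
  then obtain xs0 where "rtrancl_path R u xs0 u'"
    unfolding rtranclp_eq_rtrancl_path by blast
  then obtain xs where path: "rtrancl_path R u xs u'" and dist: "distinct (u # xs)"
    by (rule rtrancl_path_distinct) blast
  have step: "R ((u # xs) ! i) (xs ! i)" if "i < length xs" for i
    using rtrancl_path_nth[OF path that] .
  have "xs \<noteq> []" using path \<open>u' \<noteq> u\<close> by (auto elim: rtrancl_path.cases)
  then have last: "last xs = u'" using rtrancl_path_last[OF path] by simp
  have "set xs \<subseteq> B" using step by (auto simp: R_def in_set_conv_nth)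
  let ?c = "v # u # xs"
  have "{?c ! i, ?c ! (Suc i mod length ?c)} \<in> E" if i: "i < length ?c" for i
  proof -
    consider "i = 0" | j where "i = Suc j" "j < length xs" | "i = Suc (length xs)"
      using i by (cases i) (auto simp: less_Suc_eq)
    then show ?thesis
    proof cases
      case 1
      then show ?thesis using \<open>{v, u} \<in> E\<close> by simp
    next
      case 2
      then show ?thesis using step[of j] by (simp add: R_def)
    next
      case 3
      have "(u # xs) ! length xs = u'"
        using last \<open>xs \<noteq> []\<close> by (simp add: last_conv_nth nth_Cons')
      then show ?thesis using 3 \<open>{v, u'} \<in> E\<close> by (simp add: insert_commute)
    qed
  qed
  moreover have "distinct ?c" using dist \<open>u \<in> B\<close> \<open>v \<notin> B\<close> \<open>set xs \<subseteq> B\<close> by auto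
  moreover have "3 \<le> length ?c" using \<open>xs \<noteq> []\<close> by (cases xs) auto
  ultimately have "graph_cycle E ?c" unfolding graph_cycle_def by blast
  with acyclic show False by blast
qed

text \<open>
  A proper nonempty vertex set of a connected graph has an edge leaving it, so a connected part can be
  enlarged by single vertices until it is everything. Acyclicity makes the attaching edge unique.
  The induction carries along that the part \<open>B\<close> is connected by paths inside itself.
\<close>

lemma tree_induct [consumes 3, case_names single grow]:
  assumes "finite V" "is_tree V E" "\<Union>E \<subseteq> V"
    and single: "\<And>x. x \<in> V \<Longrightarrow> P {x}"
    and grow: "\<And>B u v. \<lbrakk>B \<subseteq> V; u \<in> B; v \<in> V; v \<notin> B; {v, u} \<in> E;
        \<And>w. w \<in> B \<Longrightarrow> {v, w} \<in> E \<Longrightarrow> w = u; P B\<rbrakk> \<Longrightarrow> P (insert v B)"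
  shows "P V"
proof -
  define R where "R B = {(a, b). a \<in> B \<and> b \<in> B \<and> {a, b} \<in> E}" for B
  have ne: "V \<noteq> {}" and conn: "\<And>x y. x \<in> V \<Longrightarrow> y \<in> V \<Longrightarrow> (x, y) \<in> {(u, v). {u, v} \<in> E}\<^sup>*"
    and acyclic: "\<not> (\<exists>c. graph_cycle E c)"
    using assms(2) by (auto simp: is_tree_def graph_connected_def)
  have "\<exists>B\<subseteq>V. card B = Suc n \<and> (\<forall>x\<in>B. \<forall>y\<in>B. (x, y) \<in> (R B)\<^sup>*) \<and> P B" if "n < card V" for n
    using that
  proof (induction n)
    case 0
    obtain x where "x \<in> V" using ne by blast
    then show ?case using single by (intro exI[of _ "{x}"]) auto
  next
    case (Suc n)
    then obtain B where B: "B \<subseteq> V" "card B = Suc n" "\<And>x y. x\<in>B \<Longrightarrow> y\<in>B \<Longrightarrow> (x, y) \<in> (R B)\<^sup>*" "P B"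
      by auto
    have finB: "finite B" using B(2) card.infinite by fastforce
    obtain x where x: "x \<in> B" using B(2) by fastforce
    have "B \<noteq> V" using B(2) Suc.prems by auto
    then obtain w where w: "w \<in> V" "w \<notin> B" using B(1) by blast
    have "(x, w) \<in> {(u, v). {u, v} \<in> E}\<^sup>*" using conn x w B(1) by blast
    then have "\<exists>u v. u \<in> B \<and> v \<notin> B \<and> {u, v} \<in> E" using w(2)
    proof (induction rule: rtrancl_induct)
      case (step y z)
      then show ?case by blast
    qed (use x in blast)
    then obtain u v where uv: "u \<in> B" "v \<notin> B" "{u, v} \<in> E" by blast
    then have vV: "v \<in> V" and vu: "{v, u} \<in> E" using assms(3) by (auto simp: insert_commute)
    have "P (insert v B)"
    proof (rule grow[OF B(1) uv(1) vV uv(2) vu _ B(4)])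
      fix w assume "w \<in> B" "{v, w} \<in> E"
      then show "w = u"
        using unique_neighbour_in_connected[OF acyclic B(3)[unfolded R_def, OF uv(1)] uv(1,2) vu] by blast
    qed
    moreover have "(y, z) \<in> (R (insert v B))\<^sup>*" if "y \<in> insert v B" "z \<in> insert v B" for y z
    proof -
      have sub: "(R B)\<^sup>* \<subseteq> (R (insert v B))\<^sup>*" by (rule rtrancl_mono) (auto simp: R_def)
      have vu': "(v, u) \<in> R (insert v B)" "(u, v) \<in> R (insert v B)"
        using uv vu by (auto simp: R_def)
      have "(y, u) \<in> (R (insert v B))\<^sup>*"
        using that(1) sub B(3)[of y u] uv(1) vu' by blast
      moreover have "(u, z) \<in> (R (insert v B))\<^sup>*"
        using that(2) sub B(3)[of u z] uv(1) vu' by blast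
      ultimately show ?thesis by (rule rtrancl_trans)
    qed
    ultimately show ?case
      using B uv vV finB by (intro exI[of _ "insert v B"]) auto
  qed
  from this[of "card V - 1"] ne assms(1) obtain B where "B \<subseteq> V" "card B = card V" "P B"
    by (auto simp: card_gt_0_iff)
  then show ?thesis using assms(1) card_subset_eq by blast
qed

text \<open>
  Here \<open>X i j\<close> is the set of admissible images of vertices of rank \<open>j\<close> while \<open>i\<close> vertices remain
  to be embedded. The candidate sets grow as \<open>i\<close> falls, so images chosen early remain admissible.
  A point that is admissible with \<open>i + 1\<close> vertices to go has, on every other level, comparable points
  that are admissible with \<open>i\<close> to go and avoid a prescribed small set \<open>T\<close>; this makes room for the
  one neighbour that is attached at that moment. For levels that never run out, \<open>X\<close> is constant in
  \<open>i\<close>; for the cube, each step back in \<open>i\<close> undoes one round of pruning.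
\<close>

lemma tree_poset_embeds:
  fixes A :: "'a set" and F :: "'b::order set" and X :: "nat \<Rightarrow> nat \<Rightarrow> 'b set"
  assumes "finite A" "partial_order_on A r" "is_tree A (hasse_edges r)"
    and sub: "\<And>j. j < height r \<Longrightarrow> X 0 j \<subseteq> F"
    and dec: "\<And>i j. j < height r \<Longrightarrow> X (Suc i) j \<subseteq> X i j"
    and ne: "\<And>j. j < height r \<Longrightarrow> X (card A) j \<noteq> {}"
    and extend: "\<And>i j j' y T. \<lbrakk>j < height r; j' < height r; j \<noteq> j'; y \<in> X (Suc i) j;
        finite T; card T \<le> card A\<rbrakk> \<Longrightarrow>
        \<exists>z \<in> X i j'. z \<notin> T \<and> (j' < j \<longrightarrow> z \<le> y) \<and> (j < j' \<longrightarrow> y \<le> z)"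
  shows "subposet A r F (relation_of (\<le>) F)"
proof -
  let ?E = "hasse_edges r"
  have rA: "r \<subseteq> A \<times> A"
    using assms(2) by (auto simp: partial_order_on_def preorder_on_def refl_on_def)
  have EA: "\<Union>?E \<subseteq> A" using rA unfolding hasse_edges_def by blast
  have antisym: "antisym r" using assms(2) by (auto simp: partial_order_on_def)
  have irrefl: "x \<noteq> y" if "{x, y} \<in> ?E" for x y
    using that by (auto simp: hasse_edges_def doubleton_eq_iff)
  have dec': "X i j \<subseteq> X i' j" if "i' \<le> i" "j < height r" for i i' j
    using lift_Suc_antimono_le[of "\<lambda>i. X i j", OF _ that(1)] dec[OF that(2)] by blast
  define Q where "Q B = (\<exists>f. inj_on f B \<and> (\<forall>x\<in>B. f x \<in> X (card A - card B) (rank r x)) \<and>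
      (\<forall>x\<in>B. \<forall>y\<in>B. {x, y} \<in> ?E \<longrightarrow> (x, y) \<in> r \<longrightarrow> f x \<le> f y))" for B
  have "Q A"
    using assms(1,3) EA
  proof (induction rule: tree_induct)
    case (single x)
    have h: "rank r x < height r" by (rule rank_less_height[OF assms(1,2) single])
    obtain b where "b \<in> X (card A) (rank r x)" using ne[OF h] by blast
    then have "b \<in> X (card A - card {x}) (rank r x)" using dec'[OF _ h] by (meson diff_le_self subsetD)
    then show ?case unfolding Q_def by (intro exI[of _ "\<lambda>_. b"]) auto
  next
    case (grow B u v)
    then obtain f where inj: "inj_on f B"
      and f: "\<And>x. x \<in> B \<Longrightarrow> f x \<in> X (card A - card B) (rank r x)"
      and mono: "\<And>x y. x \<in> B \<Longrightarrow> y \<in> B \<Longrightarrow> {x, y} \<in> ?E \<Longrightarrow> (x, y) \<in> r \<Longrightarrow> f x \<le> f y"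
      unfolding Q_def by blast
    have finB: "finite B" using grow assms(1) finite_subset by blast
    have "card (insert v B) \<le> card A" using grow assms(1) by (intro card_mono) auto
    then have less: "card B < card A" using finB grow by simp
    define i where "i = card A - card (insert v B)"
    have i: "card A - card B = Suc i" using less finB grow by (simp add: i_def)
    have "card (f ` B) \<le> card A" using less card_image_le[OF finB, of f] by linarith
    moreover have "u \<in> A" using grow by blast
    moreover have "rank r v \<noteq> rank r u"
    proof -
      have "(v, u) \<in> r \<and> v \<noteq> u \<or> (u, v) \<in> r \<and> v \<noteq> u"
        using grow(5) unfolding hasse_edges_def by (auto simp: doubleton_eq_iff)
      then show ?thesis using rank_strict_mono[OF assms(1,2)] by (metis less_irrefl)
    qed
    ultimately obtain z where z: "z \<in> X i (rank r v)" "z \<notin> f ` B"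
      "rank r v < rank r u \<Longrightarrow> z \<le> f u" "rank r u < rank r v \<Longrightarrow> f u \<le> z"
      using extend[of "rank r u" "rank r v" "f u" i "f ` B"] rank_less_height[OF assms(1,2)]
        f[OF grow(2)] finB grow(3) i by fastforce
    let ?f = "f(v := z)"
    have "inj_on ?f (insert v B)"
      using inj z(2) grow(4) by (auto simp: inj_on_def)
    moreover have "?f x \<in> X i (rank r x)" if "x \<in> insert v B" for x
    proof (cases "x = v")
      case False
      then have "x \<in> B" using that by simp
      then show ?thesis using f[of x] False i dec[of "rank r x" i] grow(1)
          rank_less_height[OF assms(1,2), of x] by auto
    qed (use z in simp)
    moreover have "?f x \<le> ?f y"
      if "x \<in> insert v B" "y \<in> insert v B" "{x, y} \<in> ?E" "(x, y) \<in> r" for x y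
    proof -
      have xy: "x \<noteq> y" using irrefl that(3) by blast
      have rk: "rank r x < rank r y" using rank_strict_mono[OF assms(1,2) that(4) xy] .
      consider "x = v" "y = u" | "y = v" "x = u" | "x \<in> B" "y \<in> B" "x \<noteq> v" "y \<noteq> v"
      proof -
        have "{v, y} \<in> ?E" if "x = v" using that \<open>{x, y} \<in> ?E\<close> by simp
        moreover have "{v, x} \<in> ?E" if "y = v"
          using that \<open>{x, y} \<in> ?E\<close> by (simp add: insert_commute)
        ultimately show thesis using that xy \<open>x \<in> insert v B\<close> \<open>y \<in> insert v B\<close> grow(6) by blast
      qed
      then show ?thesis
        using z rk grow(2,4) mono[of x y] that by cases auto
    qed
    ultimately show ?case unfolding Q_def i_def[symmetric] by (intro exI[of _ ?f]) blast
  qed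
  then obtain f where inj: "inj_on f A" and f: "\<And>x. x \<in> A \<Longrightarrow> f x \<in> X 0 (rank r x)"
    and mono: "\<And>x y. x \<in> A \<Longrightarrow> y \<in> A \<Longrightarrow> {x, y} \<in> ?E \<Longrightarrow> (x, y) \<in> r \<Longrightarrow> f x \<le> f y"
    unfolding Q_def by auto
  have "f x \<le> f y" if "(x, y) \<in> r" for x y
    by (rule monotone_if_monotone_on_hasse_edges[OF assms(1,2) _ that]) (use mono rA in blast)
  moreover have "f ` A \<subseteq> F"
    using f sub rank_less_height[OF assms(1,2)] by blast
  ultimately show ?thesis
    unfolding subposet_def relation_of_def using inj by (intro exI[of _ f]) auto
qed

section \<open>Chains and unions of few antichains\<close>

lemma subposet_mono:
  assumes "subposet A r C (relation_of (\<le>) C)" "C \<subseteq> F"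
  shows "subposet A r F (relation_of (\<le>) F)"
proof -
  obtain f where "inj_on f A" "f ` A \<subseteq> C" "\<forall>a\<in>A. \<forall>b\<in>A. (a, b) \<in> r \<longrightarrow> (f a, f b) \<in> relation_of (\<le>) C"
    using assms(1) unfolding subposet_def by blast
  then show ?thesis
    using assms(2) unfolding subposet_def relation_of_def by (intro exI[of _ f]) auto
qed

text \<open>
  Any linear extension of the poset can be laid out along the chain. The function \<open>\<phi>\<close> certifies that
  the relation is acyclic: an element maximising it is sent to the top of the chain. With
  \<open>{..<k}\<close> for the poset, the same statement picks \<open>k\<close> increasing members of a chain.
\<close>

lemma embeds_in_long_chain:
  fixes C :: "'b::order set" and \<phi> :: "'a \<Rightarrow> nat"
  assumes "finite A" and less: "\<And>a b. a \<in> A \<Longrightarrow> b \<in> A \<Longrightarrow> (a, b) \<in> r \<Longrightarrow> a \<noteq> b \<Longrightarrow> \<phi> a < \<phi> b"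
    and "finite C" "\<And>x y. x \<in> C \<Longrightarrow> y \<in> C \<Longrightarrow> x \<le> y \<or> y \<le> x" "card A \<le> card C"
  shows "subposet A r C (relation_of (\<le>) C)"
  using assms
proof (induction "card A" arbitrary: A C)
  case 0
  then show ?case by (auto simp: subposet_def)
next
  case (Suc n)
  have "A \<noteq> {}" "C \<noteq> {}" using Suc by auto
  then obtain t where t: "t \<in> C" "\<And>x. x \<in> C \<Longrightarrow> t \<le> x \<Longrightarrow> t = x"
    using finite_has_maximal[of C] Suc.prems(3) by metis
  have top: "x \<le> t" if "x \<in> C" for x using t Suc.prems(4)[of x t] that by auto
  obtain a where a: "a \<in> A" "\<And>b. b \<in> A \<Longrightarrow> \<phi> b \<le> \<phi> a"
  proof -
    have "Max (\<phi> ` A) \<in> \<phi> ` A" using \<open>A \<noteq> {}\<close> Suc.prems(1) by (intro Max_in) auto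
    then obtain a where "a \<in> A" "\<phi> a = Max (\<phi> ` A)" by force
    with that[of a] Suc.prems(1) show thesis by simp
  qed
  have "n = card (A - {a})" using Suc a by simp
  then have "subposet (A - {a}) r (C - {t}) (relation_of (\<le>) (C - {t}))"
  proof (rule Suc.hyps(1))
    show "card (A - {a}) \<le> card (C - {t})" using Suc.prems a t by simp
  qed (use Suc.prems in auto)
  then obtain f where f: "inj_on f (A - {a})" "f ` (A - {a}) \<subseteq> C - {t}"
     "\<And>x y. x \<in> A - {a} \<Longrightarrow> y \<in> A - {a} \<Longrightarrow> (x, y) \<in> r \<Longrightarrow> f x \<le> f y"
    unfolding subposet_def relation_of_def by auto
  let ?f = "f(a := t)"
  have "inj_on ?f A" using f(1,2) by (auto simp: inj_on_def)
  moreover have fC: "?f ` A \<subseteq> C" using f(2) t(1) by auto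
  moreover have "?f x \<le> ?f y" if "x \<in> A" "y \<in> A" "(x, y) \<in> r" for x y
  proof (cases "y = a")
    case True
    have "?f x \<in> C" using fC that(1) by blast
    then show ?thesis using top True by auto
  next
    case False
    then have "x \<noteq> a" using Suc.prems(2)[of x y] that a(2)[of y] by fastforce
    then show ?thesis using False that f(3)[of x y] by simp
  qed
  ultimately show ?case unfolding subposet_def relation_of_def by (intro exI[of _ ?f]) auto
qed

text \<open>
  The image of a longest chain has its elements on pairwise different levels.
\<close>

lemma poset_free_if_few_levels:
  fixes F :: "'b::order set"
  assumes "finite A" "partial_order_on A r"
    and less: "\<And>x y. x \<in> F \<Longrightarrow> y \<in> F \<Longrightarrow> x < y \<Longrightarrow> lev x \<noteq> lev y"
    and "finite Z" "lev ` F \<subseteq> Z" "card Z < height r"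
  shows "poset_free A r F"
  unfolding poset_free_def
proof
  assume "subposet A r F (relation_of (\<le>) F)"
  then obtain f where f: "inj_on f A" "f ` A \<subseteq> F"
     "\<And>x y. x \<in> A \<Longrightarrow> y \<in> A \<Longrightarrow> (x, y) \<in> r \<Longrightarrow> f x \<le> f y"
    unfolding subposet_def relation_of_def by auto
  obtain C where C: "C \<in> Chains r" "card C = height r"
    using obtain_longest_chain[OF assms(1,2)] .
  have CA: "C \<subseteq> A" using finite_Chains(2)[OF assms(1,2) C(1)] .
  have "inj_on (lev \<circ> f) C"
  proof (rule inj_onI, rule ccontr)
    fix x y assume xy: "x \<in> C" "y \<in> C" "(lev \<circ> f) x = (lev \<circ> f) y" "x \<noteq> y"
    then have "f x \<noteq> f y" using f(1) CA by (auto simp: inj_on_def)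
    moreover have "(x, y) \<in> r \<or> (y, x) \<in> r" using C(1) xy by (auto simp: Chains_def)
    ultimately have "f x < f y \<or> f y < f x" using f(3) xy CA by (metis order_le_less subsetD)
    then show False using less[of "f x" "f y"] less[of "f y" "f x"] xy f(2) CA by fastforce
  qed
  then have "card C \<le> card Z"
    by (rule card_inj_on_le) (use f(2) CA assms(4,5) in auto)
  then show False using C(2) assms(6) by simp
qed
section \<open>Levels of monotone sequences\<close>

lemma Mon_cases: "f \<in> Mon \<Longrightarrow> f n = 0 \<or> f n = 1"
  unfolding Mon_def by blast

lemma Mon_eventually:
  assumes "f \<in> Mon"
  obtains N where "0 < N" "\<And>n. N \<le> n \<Longrightarrow> f n = 1" "\<And>n. n \<le> - N \<Longrightarrow> f n = 0"
proof -
  obtain N where N: "\<And>n. N \<le> n \<Longrightarrow> f n = 1 \<and> f (- n) = 0"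
    using assms unfolding Mon_def eventually_at_top_linorder by blast
  show thesis
  proof (rule that[of "max 1 N"])
    fix n :: int assume "n \<le> - max 1 N"
    then have "N \<le> - n" by simp
    then show "f n = 0" using N[of "- n"] by simp
  qed (use N in auto)
qed

lemma MonI:
  assumes "\<And>n. f n = 0 \<or> f n = 1" "\<And>n. N \<le> n \<Longrightarrow> f n = 1" "\<And>n. n \<le> - N \<Longrightarrow> f n = 0"
  shows "f \<in> Mon"
  using assms unfolding Mon_def eventually_at_top_linorder by (auto intro!: exI[of _ N])

lemma finite_diff_Mon:
  assumes "f \<in> Mon" "g \<in> Mon"
  shows "finite {n. f n - g n \<noteq> 0}"
proof -
  obtain N where N: "\<And>n. N \<le> n \<Longrightarrow> f n = 1" "\<And>n. n \<le> - N \<Longrightarrow> f n = 0"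
    using Mon_eventually[OF assms(1)] by metis
  obtain M where M: "\<And>n. M \<le> n \<Longrightarrow> g n = 1" "\<And>n. n \<le> - M \<Longrightarrow> g n = 0"
    using Mon_eventually[OF assms(2)] by metis
  have "{n. f n - g n \<noteq> 0} \<subseteq> {- max N M..max N M}"
  proof
    fix n assume n: "n \<in> {n. f n - g n \<noteq> 0}"
    show "n \<in> {- max N M..max N M}"
    proof (rule ccontr)
      assume "n \<notin> {- max N M..max N M}"
      then have "(N \<le> n \<and> M \<le> n) \<or> (n \<le> - N \<and> n \<le> - M)" by auto
      then have "f n = g n" using N M by auto
      then show False using n by simp
    qed
  qed
  then show ?thesis by (rule finite_subset) simp
qed

text \<open>
  The shift is chosen so that \<open>step_fun z\<close> is a representative of the level with index \<open>z\<close>.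
\<close>

definition step_fun :: "int \<Rightarrow> int \<Rightarrow> int" where
  "step_fun z n = (if - z < n then 1 else 0)"

lemma step_fun_in_Mon: "step_fun z \<in> Mon"
  by (rule MonI[of _ "\<bar>z\<bar> + 1"]) (auto simp: step_fun_def)

text \<open>
  The signed number of ones in excess of the step at \<open>0\<close>. Up to the choice of the origin, it
  numbers the levels, which thereby become its fibres (\<open>Collect_is_level\<close>).
\<close>

definition level_index :: "(int \<Rightarrow> int) \<Rightarrow> int" where
  "level_index f = Sum_any (\<lambda>n. f n - step_fun 0 n)"

lemma Sum_any_diff_Mon:
  assumes "f \<in> Mon" "g \<in> Mon"
  shows "Sum_any (\<lambda>n. f n - g n) = level_index f - level_index g"
proof -
  have "level_index f = Sum_any (\<lambda>n. (f n - g n) + (g n - step_fun 0 n))" by (simp add: level_index_def)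
  also have "\<dots> = Sum_any (\<lambda>n. f n - g n) + level_index g"
    unfolding level_index_def
    by (rule Sum_any.distrib) (use assms finite_diff_Mon step_fun_in_Mon in blast)+
  finally show ?thesis by simp
qed

lemma level_index_add_indicator:
  assumes "f \<in> Mon" "g \<in> Mon" "finite D" "\<And>n. f n = g n + (if n \<in> D then 1 else 0)"
  shows "level_index f = level_index g + card D"
proof -
  have "Sum_any (\<lambda>n. f n - g n) = (\<Sum>n\<in>D. f n - g n)"
    by (rule Sum_any.expand_superset) (use assms(3,4) in \<open>auto split: if_splits\<close>)
  also have "\<dots> = card D" using assms(4) by simp
  finally show ?thesis using Sum_any_diff_Mon[OF assms(1,2)] by simp
qed

lemma level_index_strict_mono:
  assumes "f \<in> Mon" "g \<in> Mon" "f < g"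
  shows "level_index f < level_index g"
proof -
  have le: "f n \<le> g n" for n using assms(3) by (simp add: less_le le_fun_def)
  let ?D = "{n. g n - f n \<noteq> 0}"
  have "?D \<noteq> {}" using assms(3) by (auto simp: less_le)
  moreover have "finite ?D" by (rule finite_diff_Mon[OF assms(2,1)])
  moreover have "g n = f n + (if n \<in> ?D then 1 else 0)" for n
    using le[of n] Mon_cases[OF assms(1), of n] Mon_cases[OF assms(2), of n] by auto
  ultimately show ?thesis
    using level_index_add_indicator[OF assms(2,1)] by (metis card_gt_0_iff less_add_same_cancel1 of_nat_0_less_iff)
qed

definition level :: "int \<Rightarrow> (int \<Rightarrow> int) set" where
  "level z = {f \<in> Mon. level_index f = z}"

text \<open>
  All members of \<open>T\<close> and \<open>y\<close> itself are constantly one from some position \<open>M\<close> on. Turning a block of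
  ones of \<open>y\<close> that starts at \<open>M\<close> into zeros gives a sequence below \<open>y\<close> that differs at \<open>M\<close> from
  every member of \<open>T\<close>.
\<close>

lemma exists_below_in_level_avoiding:
  assumes y: "y \<in> level z" and "z' < z" and T: "finite T" "T \<subseteq> Mon"
  shows "\<exists>x\<in>level z'. x \<notin> T \<and> x \<le> y"
proof -
  have yM: "y \<in> Mon" using y by (simp add: level_def)
  have "\<forall>t\<in>insert y T. \<exists>N. \<forall>n\<ge>N. t n = 1" using yM T(2) Mon_eventually by (metis insert_iff subsetD)
  then obtain N where N: "\<And>t n. t \<in> insert y T \<Longrightarrow> N t \<le> n \<Longrightarrow> t n = 1" by metis
  define M where "M = Max (N ` insert y T)"
  have M: "t n = 1" if "t \<in> insert y T" "M \<le> n" for t n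
  proof -
    have "N t \<le> M" unfolding M_def using T(1) that(1) by (intro Max_ge) auto
    then show ?thesis using N that by auto
  qed
  define D where "D = {M..<M + (z - z')}"
  define x where "x n = (if n \<in> D then 0 else y n)" for n
  obtain K where K: "0 < K" "\<And>n. K \<le> n \<Longrightarrow> y n = 1" "\<And>n. n \<le> - K \<Longrightarrow> y n = 0"
    using Mon_eventually[OF yM] by metis
  have xM: "x \<in> Mon"
    by (rule MonI[of _ "max K (M + (z - z'))"])
      (use K Mon_cases[OF yM] in \<open>auto simp: x_def D_def\<close>)
  have "level_index y = level_index x + card D"
    by (rule level_index_add_indicator[OF yM xM]) (use M in \<open>auto simp: x_def D_def\<close>)
  then have "x \<in> level z'" using xM y assms(2) by (simp add: level_def D_def)
  moreover have "x \<notin> T"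
  proof
    assume "x \<in> T"
    then have "x M = 1" using M by blast
    then show False using assms(2) by (simp add: x_def D_def)
  qed
  moreover have "x \<le> y"
  proof (rule le_funI)
    show "x n \<le> y n" for n using Mon_cases[OF yM, of n] by (auto simp: x_def)
  qed
  ultimately show ?thesis by blast
qed

text \<open>
  The mirror image of the preceding argument: a block of zeros far to the left is turned into ones.
\<close>

lemma exists_above_in_level_avoiding:
  assumes y: "y \<in> level z" and "z < z'" and T: "finite T" "T \<subseteq> Mon"
  shows "\<exists>x\<in>level z'. x \<notin> T \<and> y \<le> x"
proof -
  have yM: "y \<in> Mon" using y by (simp add: level_def)
  have "\<forall>t\<in>insert y T. \<exists>N. \<forall>n\<le>N. t n = 0" using yM T(2) Mon_eventually by (metis insert_iff subsetD)
  then obtain N where N: "\<And>t n. t \<in> insert y T \<Longrightarrow> n \<le> N t \<Longrightarrow> t n = 0" by metis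
  define M where "M = Min (N ` insert y T)"
  have M: "t n = 0" if "t \<in> insert y T" "n \<le> M" for t n
  proof -
    have "M \<le> N t" unfolding M_def using T(1) that(1) by (intro Min_le) auto
    then show ?thesis using N that by auto
  qed
  define D where "D = {M - (z' - z)<..M}"
  define x where "x n = (if n \<in> D then 1 else y n)" for n
  obtain K where K: "0 < K" "\<And>n. K \<le> n \<Longrightarrow> y n = 1" "\<And>n. n \<le> - K \<Longrightarrow> y n = 0"
    using Mon_eventually[OF yM] by metis
  have xM: "x \<in> Mon"
    by (rule MonI[of _ "max K (- (M - (z' - z)))"])
      (use K Mon_cases[OF yM] in \<open>auto simp: x_def D_def\<close>)
  have "level_index x = level_index y + card D"
    by (rule level_index_add_indicator[OF xM yM]) (use M in \<open>auto simp: x_def D_def\<close>)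
  then have "x \<in> level z'" using xM y assms(2) by (simp add: level_def D_def)
  moreover have "x \<notin> T"
  proof
    assume "x \<in> T"
    then have "x M = 0" using M by blast
    then show False using assms(2) by (simp add: x_def D_def)
  qed
  moreover have "y \<le> x"
  proof (rule le_funI)
    show "y n \<le> x n" for n using Mon_cases[OF yM, of n] by (auto simp: x_def)
  qed
  ultimately show ?thesis by blast
qed

lemma step_fun_in_level: "step_fun z \<in> level z"
proof -
  have "level_index (step_fun z) = z"
  proof (cases "0 \<le> z")
    case True
    have "level_index (step_fun z) = level_index (step_fun 0) + card {- z<..0}"
      by (rule level_index_add_indicator[OF step_fun_in_Mon step_fun_in_Mon]) (use True in \<open>auto simp: step_fun_def\<close>)
    then show ?thesis using True by (simp add: level_index_def)
  next
    case False
    have "level_index (step_fun 0) = level_index (step_fun z) + card {0<..- z}"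
      by (rule level_index_add_indicator[OF step_fun_in_Mon step_fun_in_Mon]) (use False in \<open>auto simp: step_fun_def\<close>)
    then show ?thesis using False by (simp add: level_index_def)
  qed
  then show ?thesis using step_fun_in_Mon by (simp add: level_def)
qed

lemma same_level_iff: "same_level L \<longleftrightarrow> (\<exists>z. L \<subseteq> level z)"
proof
  assume L: "same_level L"
  show "\<exists>z. L \<subseteq> level z"
  proof (cases "L = {}")
    case False
    then obtain g where g: "g \<in> L" by blast
    have "L \<subseteq> level (level_index g)"
      using L g Sum_any_diff_Mon unfolding same_level_def level_def by fastforce
    then show ?thesis by blast
  qed auto
next
  assume "\<exists>z. L \<subseteq> level z"
  then show "same_level L"
    unfolding same_level_def level_def by (auto simp: subset_iff Sum_any_diff_Mon)
qed

lemma inj_level: "inj level"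
proof (rule injI)
  fix z z' assume "level z = level z'"
  then have "step_fun z \<in> level z'" using step_fun_in_level[of z] by simp
  then show "z = z'" using step_fun_in_level[of z] by (simp add: level_def)
qed

lemma Collect_is_level: "Collect is_level = range level"
proof -
  have eq: "z = z'" if "level z \<subseteq> level z'" for z z'
    using that step_fun_in_level[of z] by (auto simp: level_def)
  have "is_level (level z)" for z
    unfolding is_level_def same_level_iff using eq by blast
  moreover have "\<exists>z. L = level z" if "is_level L" for L
    using that unfolding is_level_def same_level_iff by blast
  ultimately show ?thesis by blast
qed

lemma many_levels_contain_tree:
  assumes "finite A" "partial_order_on A r" "is_tree A (hasse_edges r)"
    and "finite Z" "height r \<le> card Z"
  shows "\<not> poset_free A r (\<Union>(level ` Z))"
proof -
  have "subposet {..<height r} {(i, j). i \<le> j} Z (relation_of (\<le>) Z)"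
    by (rule embeds_in_long_chain[where \<phi> = id]) (use assms(4,5) in auto)
  then obtain g where g: "inj_on g {..<height r}" "g ` {..<height r} \<subseteq> Z"
    "\<And>i j. i < height r \<Longrightarrow> j < height r \<Longrightarrow> i \<le> j \<Longrightarrow> g i \<le> g j"
    unfolding subposet_def relation_of_def by auto
  have g_less: "g i < g j" if "i < j" "j < height r" for i j
  proof -
    have "g i \<noteq> g j" using g(1) that by (auto simp: inj_on_def)
    then show ?thesis using g(3)[of i j] that by simp
  qed
  have "subposet A r (\<Union>(level ` Z)) (relation_of (\<le>) (\<Union>(level ` Z)))"
  proof (rule tree_poset_embeds[OF assms(1-3), where X = "\<lambda>_ j. level (g j)"])
    fix j j' y and T :: "(int \<Rightarrow> int) set"
    assume *: "j < height r" "j' < height r" "j \<noteq> j'" "y \<in> level (g j)" "finite T"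
    have "finite (T \<inter> Mon)" "T \<inter> Mon \<subseteq> Mon" using * by auto
    then have "\<exists>z\<in>level (g j'). z \<notin> T \<inter> Mon \<and> (j' < j \<longrightarrow> z \<le> y) \<and> (j < j' \<longrightarrow> y \<le> z)"
      using exists_below_in_level_avoiding[OF *(4), of "g j'" "T \<inter> Mon"]
        exists_above_in_level_avoiding[OF *(4), of "g j'" "T \<inter> Mon"]
        g_less[of j j'] g_less[of j' j] * by (metis less_asym nat_neq_iff)
    then show "\<exists>z\<in>level (g j'). z \<notin> T \<and> (j' < j \<longrightarrow> z \<le> y) \<and> (j < j' \<longrightarrow> y \<le> z)"
      by (auto simp: level_def)
  next
    show "level (g j) \<noteq> {}" for j using step_fun_in_level by blast
  qed (use g(2) in auto)
  then show ?thesis by (simp add: poset_free_def)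
qed

lemma few_levels_poset_free:
  assumes "finite A" "partial_order_on A r" "finite Z" "card Z < height r"
  shows "poset_free A r (\<Union>(level ` Z))"
proof (rule poset_free_if_few_levels[OF assms(1,2) _ assms(3) _ assms(4), where lev = level_index])
  fix f g assume "f \<in> \<Union>(level ` Z)" "g \<in> \<Union>(level ` Z)" "f < g"
  then show "level_index f \<noteq> level_index g"
    using level_index_strict_mono[of f g] by (auto simp: level_def)
qed (auto simp: level_def)

lemma max_levels_tree:
  assumes "finite A" "partial_order_on A r" "is_tree A (hasse_edges r)"
  shows "max_levels A r = enat (height r - 1)"
proof (rule antisym)
  show "max_levels A r \<le> enat (height r - 1)"
    unfolding max_levels_def
  proof (rule SUP_least)
    fix S assume S: "S \<in> {S. finite S \<and> S \<subseteq> Collect is_level \<and> poset_free A r (\<Union> S)}"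
    then obtain Z where Z: "finite Z" "S = level ` Z"
      using finite_subset_image[of S level UNIV] by (auto simp: Collect_is_level)
    then have "card S = card Z" using card_image inj_level subset_UNIV inj_on_subset by metis
    moreover have "card Z < height r"
      using many_levels_contain_tree[OF assms Z(1)] S Z(2) by fastforce
    ultimately show "enat (card S) \<le> enat (height r - 1)" by simp
  qed
  let ?Z = "int ` {..<height r - 1}"
  have Z: "finite ?Z" "card ?Z = height r - 1" by (auto simp: card_image)
  have "poset_free A r (\<Union>(level ` ?Z))"
    by (rule few_levels_poset_free[OF assms(1,2)]) (use Z tree_height_pos[OF assms] in auto)
  moreover have "card (level ` ?Z) = height r - 1"
    using Z(2) card_image inj_level inj_on_subset by (metis subset_UNIV)
  ultimately show "enat (height r - 1) \<le> max_levels A r"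
    unfolding max_levels_def using Collect_is_level
    by (intro SUP_upper2[of "level ` ?Z"]) auto
qed

section \<open>Full chains as permutations\<close>

text \<open>
  A full chain of subsets of \<open>V\<close> is encoded by the order in which the elements of \<open>V\<close> are added, so
  its members are the sets of entries of the prefixes of a permutation of \<open>V\<close>.
\<close>

definition on_chain :: "'a set \<Rightarrow> 'a list \<Rightarrow> bool" where
  "on_chain Y xs \<longleftrightarrow> (\<exists>ys zs. xs = ys @ zs \<and> set ys = Y)"

lemma on_chain_comparable:
  assumes "on_chain Y xs" "on_chain Z xs"
  shows "Y \<subseteq> Z \<or> Z \<subseteq> Y"
proof -
  obtain ys zs ys' zs' where "xs = ys @ zs" "set ys = Y" "xs = ys' @ zs'" "set ys' = Z"
    using assms unfolding on_chain_def by blast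
  then show ?thesis by (auto simp: append_eq_append_conv2)
qed

text \<open>
  A full chain through \<open>Y\<close> consists of a full chain of \<open>Y\<close> followed by one of the complement.
\<close>

lemma permutations_through:
  assumes "Y \<subseteq> V"
  shows "{xs \<in> permutations_of_set V. on_chain Y xs} =
    (\<lambda>(ys, zs). ys @ zs) ` (permutations_of_set Y \<times> permutations_of_set (V - Y))"
    (is "?L = ?R")
proof
  show "?L \<subseteq> ?R"
  proof
    fix xs assume "xs \<in> ?L"
    then obtain ys zs where "xs = ys @ zs" "set ys = Y" "set xs = V" "distinct xs"
      by (auto simp: on_chain_def permutations_of_set_def)
    then have "(ys, zs) \<in> permutations_of_set Y \<times> permutations_of_set (V - Y)"
      by (auto simp: permutations_of_set_def)
    then show "xs \<in> ?R" using \<open>xs = ys @ zs\<close> by force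
  qed
  show "?R \<subseteq> ?L" using assms by (auto simp: on_chain_def permutations_of_set_def)
qed

lemma inj_on_append_permutations:
  "inj_on (\<lambda>(ys, zs). ys @ zs) (permutations_of_set Y \<times> B)"
proof (rule inj_onI, clarify)
  fix ys zs ys' zs' assume "ys \<in> permutations_of_set Y" "ys' \<in> permutations_of_set Y"
    "ys @ zs = ys' @ zs'"
  then show "ys = ys' \<and> zs = zs'"
    using length_finite_permutations_of_set append_eq_append_conv by metis
qed

lemma card_permutations_through:
  assumes "finite V" "Y \<subseteq> V"
  shows "card {xs \<in> permutations_of_set V. on_chain Y xs} = fact (card Y) * fact (card V - card Y)"
proof -
  have "finite Y" using assms finite_subset by blast
  then show ?thesis
    using assms unfolding permutations_through[OF assms(2)]
    by (subst card_image[OF inj_on_append_permutations]) (simp add: card_cartesian_product card_Diff_subset)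
qed

lemma card_permutations_through_two:
  assumes "finite V" "Y \<subseteq> V" "Z \<subseteq> Y"
  shows "card {xs \<in> permutations_of_set V. on_chain Y xs \<and> on_chain Z xs}
    = fact (card Z) * fact (card Y - card Z) * fact (card V - card Y)"
proof -
  have fin: "finite Y" using assms finite_subset by blast
  let ?P = "{ys \<in> permutations_of_set Y. on_chain Z ys}"
  have eq: "{xs \<in> permutations_of_set V. on_chain Y xs \<and> on_chain Z xs} =
     (\<lambda>(ys, zs). ys @ zs) ` (?P \<times> permutations_of_set (V - Y))" (is "?L = ?R")
  proof
    show "?R \<subseteq> ?L"
    proof
      fix xs assume "xs \<in> ?R"
      then obtain ys zs where xs: "xs = ys @ zs" "ys \<in> permutations_of_set Y" "on_chain Z ys"
        "zs \<in> permutations_of_set (V - Y)" by auto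
      then obtain us vs where "ys = us @ vs" "set us = Z" by (auto simp: on_chain_def)
      then have "xs = us @ (vs @ zs)" "set us = Z" using xs(1) by auto
      then have "on_chain Z xs" unfolding on_chain_def by blast
      moreover have "on_chain Y xs"
        using xs(1) permutations_of_setD(1)[OF xs(2)] unfolding on_chain_def by blast
      moreover have "xs \<in> permutations_of_set V"
        using xs assms(2) by (auto simp: permutations_of_set_def)
      ultimately show "xs \<in> ?L" by simp
    qed
    show "?L \<subseteq> ?R"
    proof
      fix xs assume xs: "xs \<in> ?L"
      then have "xs \<in> {xs \<in> permutations_of_set V. on_chain Y xs}" by simp
      then obtain ys zs where d: "xs = ys @ zs" "ys \<in> permutations_of_set Y"
          "zs \<in> permutations_of_set (V - Y)"
        unfolding permutations_through[OF assms(2)] by auto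
      obtain us vs where u: "xs = us @ vs" "set us = Z" using xs by (auto simp: on_chain_def)
      have dist: "distinct xs" "set ys = Y" using xs d by (auto simp: permutations_of_set_def)
      have "length us = card Z" "length ys = card Y"
        using dist u d distinct_card by (metis distinct_append)+
      then have "length us \<le> length ys" using card_mono[OF fin assms(3)] by simp
      then obtain ws where "ys = us @ ws"
        using u(1) d(1) by (auto simp: append_eq_append_conv2)
      then have "on_chain Z ys" using u by (auto simp: on_chain_def)
      then show "xs \<in> ?R" using d by force
    qed
  qed
  have "inj_on (\<lambda>(ys, zs). ys @ zs) (?P \<times> permutations_of_set (V - Y))"
    by (rule inj_on_subset[OF inj_on_append_permutations]) auto
  then show ?thesis
    unfolding eq using assms fin card_permutations_through[OF fin assms(3)]
    by (subst card_image) (simp_all add: card_cartesian_product card_Diff_subset)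
qed

lemma fact_mult_fact_le:
  assumes "0 < a" "0 < b"
  shows "fact a * fact b \<le> (fact (a + b - 1) :: nat)"
  using assms(2)
proof (induction b rule: nat_induct_non_zero)
  case (Suc b)
  have "fact a * fact (Suc b) = Suc b * (fact a * fact b :: nat)" by (simp add: algebra_simps)
  also have "\<dots> \<le> (a + b) * fact (a + b - 1)"
    using Suc assms(1) by (intro mult_mono) auto
  also have "\<dots> = fact (a + Suc b - 1)"
    using assms(1) by (simp add: fact_reduce[of "a + b"])
  finally show ?case .
qed simp

text \<open>
  In probabilistic terms: a random full chain through \<open>Y\<close> passes through another given set \<open>Z\<close> with
  probability \<open>1 / (|Y| choose |Z|)\<close> or, for \<open>Z\<close> above \<open>Y\<close>, \<open>1 / (n - |Y| choose n - |Z|)\<close>. As \<open>Z\<close>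
  is proper and nonempty, this is at most the inverse of \<open>|Y|\<close> or of \<open>n - |Y|\<close>, both of which are at
  least \<open>n / 4\<close>.
\<close>

lemma card_permutations_through_two_le:
  assumes "finite V" "Y \<subseteq> V" "Z \<subseteq> V" "Z \<noteq> {}" "Z \<noteq> V" "Z \<noteq> Y"
    and "card V \<le> 4 * card Y" "4 * card Y \<le> 3 * card V"
  shows "card V * card {xs \<in> permutations_of_set V. on_chain Y xs \<and> on_chain Z xs}
    \<le> 4 * (fact (card Y) * fact (card V - card Y))"
proof -
  have fin: "finite Y" "finite Z" using assms finite_subset by blast+
  let ?n = "card V" and ?y = "card Y" and ?z = "card Z"
  have z: "0 < ?z" "?z < ?n"
    using fin assms psubset_card_mono[of V Z] by (auto simp: card_gt_0_iff)
  consider "Z \<subset> Y" | "Y \<subset> Z" | "\<not> Z \<subseteq> Y" "\<not> Y \<subseteq> Z" using assms(6) by blast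
  then show ?thesis
  proof cases
    case 1
    have lt: "?z < ?y" using psubset_card_mono[OF fin(1) 1] .
    have "?n * card {xs \<in> permutations_of_set V. on_chain Y xs \<and> on_chain Z xs}
        = ?n * (fact ?z * fact (?y - ?z)) * fact (?n - ?y)"
      using card_permutations_through_two[OF assms(1,2), of Z] 1 by simp
    also have "\<dots> \<le> (4 * ?y) * fact (?y - 1) * fact (?n - ?y)"
      using fact_mult_fact_le[OF z(1), of "?y - ?z"] lt assms(7) by (intro mult_mono) auto
    also have "\<dots> = 4 * (fact ?y * fact (?n - ?y))"
      using lt by (simp add: fact_reduce[of ?y])
    finally show ?thesis .
  next
    case 2
    have lt: "?y < ?z" using psubset_card_mono[OF fin(2) 2] .
    have "?n * card {xs \<in> permutations_of_set V. on_chain Y xs \<and> on_chain Z xs}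
        = ?n * (fact (?z - ?y) * fact (?n - ?z)) * fact ?y"
      using card_permutations_through_two[OF assms(1,3), of Y] 2
      by (simp add: conj_commute mult_ac)
    also have "\<dots> \<le> (4 * (?n - ?y)) * fact (?n - ?y - 1) * fact ?y"
      using fact_mult_fact_le[of "?z - ?y" "?n - ?z"] lt z assms(8) by (intro mult_mono) auto
    also have "\<dots> = 4 * (fact ?y * fact (?n - ?y))"
      using lt z by (simp add: fact_reduce[of "?n - ?y"])
    finally show ?thesis .
  next
    case 3
    then have empty: "{xs \<in> permutations_of_set V. on_chain Y xs \<and> on_chain Z xs} = {}"
      using on_chain_comparable by blast
    show ?thesis unfolding empty by simp
  qed
qed

definition chain_members :: "'a set set \<Rightarrow> 'a list \<Rightarrow> 'a set set" where
  "chain_members F xs = {Y \<in> F. on_chain Y xs}"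

lemma sum_card_chain_members:
  assumes "finite V" "F \<subseteq> Pow V"
  shows "(\<Sum>xs\<in>permutations_of_set V. card (chain_members F xs))
    = (\<Sum>Y\<in>F. fact (card Y) * fact (card V - card Y))"
proof -
  have finF: "finite F" using assms finite_subset by blast
  have "(\<Sum>xs\<in>permutations_of_set V. card (chain_members F xs))
      = (\<Sum>Y\<in>F. card {xs \<in> permutations_of_set V. on_chain Y xs})"
    unfolding chain_members_def by (rule sum_multicount_gen) (use finF in auto)
  also have "\<dots> = (\<Sum>Y\<in>F. fact (card Y) * fact (card V - card Y))"
    using assms by (intro sum.cong refl card_permutations_through) auto
  finally show ?thesis .
qed

text \<open>
  The averaging argument behind the LYM inequality: a set \<open>Y\<close> lies on a fraction
  \<open>1 / (n choose |Y|)\<close> of all full chains, so it contributes at least \<open>1 / b\<close> to the average number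
  of members of \<open>F\<close> on a full chain.
\<close>

lemma card_mult_fact_le_sum_chain_members:
  fixes b :: real
  assumes "finite V" "F \<subseteq> Pow V" and "\<And>Y. Y \<in> F \<Longrightarrow> real (card V choose card Y) \<le> b"
  shows "real (card F) * fact (card V) \<le> b * (\<Sum>xs\<in>permutations_of_set V. card (chain_members F xs))"
proof -
  have "real (card F) * fact (card V) = (\<Sum>Y\<in>F. fact (card V))" by simp
  also have "\<dots> \<le> (\<Sum>Y\<in>F. b * (fact (card Y) * fact (card V - card Y)))"
  proof (rule sum_mono)
    fix Y assume "Y \<in> F"
    then have "card Y \<le> card V" using assms(1,2) card_mono by blast
    then have "real (fact (card V)) = real (card V choose card Y) * (fact (card Y) * fact (card V - card Y))"
      using arg_cong[OF binomial_fact_lemma[of "card Y" "card V"], of real] by (simp add: mult_ac)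
    also have "\<dots> \<le> b * (fact (card Y) * fact (card V - card Y))"
      using assms(3)[OF \<open>Y \<in> F\<close>] by (intro mult_right_mono) auto
    finally show "fact (card V) \<le> b * (fact (card Y) * fact (card V - card Y))" by simp
  qed
  also have "\<dots> = b * real (\<Sum>Y\<in>F. fact (card Y) * fact (card V - card Y))"
    by (simp add: sum_distrib_left)
  finally show ?thesis unfolding sum_card_chain_members[OF assms(1,2)] by simp
qed

section \<open>Binomial coefficients near to and far from the middle\<close>

lemma double_binomial_le:
  assumes "3 * (j + i) \<le> n"
  shows "2 ^ i * (n choose j) \<le> n choose (j + i)"
  using assms
proof (induction i)
  case (Suc i)
  let ?t = "j + i"
  have "Suc ?t * (2 * (n choose ?t)) \<le> (n - ?t) * (n choose ?t)"
  proof -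
    have "2 * Suc ?t \<le> n - ?t" using Suc.prems by simp
    then show ?thesis using mult_le_mono1[of "2 * Suc ?t" "n - ?t" "n choose ?t"] by (simp only: mult_ac)
  qed
  also have "\<dots> = Suc ?t * (n choose Suc ?t)"
    by (metis binomial_absorb_comp binomial_absorption mult.commute)
  finally have "2 * (n choose ?t) \<le> n choose Suc ?t" by (simp only: mult_le_cancel1)
  with Suc show ?case by simp
qed simp

text \<open>
  Between \<open>n / 4\<close> and \<open>n / 3\<close> the binomial coefficients at least double at each step, which happens about
  \<open>n / 12\<close> times; the linear lower bound for this power of two is all that an error of relative order
  \<open>1 / n\<close> needs.
\<close>

lemma binomial_outer_le:
  assumes "4 * j \<le> n \<or> 3 * n \<le> 4 * j"
  shows "n * (n choose j) \<le> 12 * (n choose (n div 2))"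
proof -
  have low: "n * (n choose i) \<le> 12 * (n choose (n div 2))" if "4 * i \<le> n" for i
  proof -
    let ?q = "n div 12"
    have "n < 12 * Suc ?q" by simp
    also have "Suc ?q \<le> 2 ^ ?q" by (simp add: Suc_leI)
    finally have "n * (n choose i) \<le> 12 * (2 ^ ?q * (n choose i))" by simp
    also have "2 ^ ?q * (n choose i) \<le> n choose (i + ?q)"
      using that by (intro double_binomial_le) simp
    also have "\<dots> \<le> n choose (n div 2)" by (rule binomial_maximum)
    finally show ?thesis by simp
  qed
  consider "4 * j \<le> n" | "n < j" | "3 * n \<le> 4 * j" "j \<le> n" using assms by linarith
  then show ?thesis
  proof cases
    case 1
    then show ?thesis by (rule low)
  next
    case 2
    then show ?thesis by (simp add: binomial_eq_0)
  next
    case 3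
    then have "4 * (n - j) \<le> n" by linarith
    then show ?thesis using low[of "n - j"] binomial_symmetric[OF 3(2)] by simp
  qed
qed

text \<open>
  Consecutive coefficients at distance \<open>t\<close> from the middle differ by at most a fraction
  \<open>(4 t + 2) / n\<close> of the largest one, and these fractions add up to a square. Bounding differences
  rather than ratios keeps the estimate valid when it is negative or when \<open>t\<close> exceeds \<open>n / 2\<close>.
\<close>

lemma binomial_near_middle_ge:
  assumes "0 < n"
  shows "real (n choose (n div 2)) * (1 - 2 * real t ^ 2 / real n) \<le> real (n choose (n div 2 + t))"
proof (induction t)
  case (Suc t)
  let ?j = "n div 2 + t" and ?B = "real (n choose (n div 2))"
  have absorb: "Suc ?j * (n choose Suc ?j) = (n - ?j) * (n choose ?j)"
    by (metis binomial_absorb_comp binomial_absorption mult.commute)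
  have "real (n choose ?j) - real (n choose Suc ?j) \<le> ?B * ((4 * real t + 2) / real n)"
  proof (cases "?j \<le> n")
    case True
    have "real (Suc ?j) * (real (n choose ?j) - real (n choose Suc ?j))
        = (real (Suc ?j) - real (n - ?j)) * real (n choose ?j)"
      using arg_cong[OF absorb, of real] by (simp only: of_nat_mult) (simp add: algebra_simps)
    also have "\<dots> \<le> (2 * real t + 1) * ?B"
    proof (rule mult_mono)
      show "real (Suc ?j) - real (n - ?j) \<le> 2 * real t + 1"
        using True by (simp add: of_nat_diff)
      show "real (n choose ?j) \<le> ?B" using binomial_maximum[of n ?j] by simp
    qed auto
    also have "\<dots> \<le> real (Suc ?j) * (?B * ((4 * real t + 2) / real n))"
    proof -
      have "real n \<le> 2 * real (Suc ?j)" by simp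
      then have "(2 * real t + 1) * real n \<le> (2 * real t + 1) * (2 * real (Suc ?j))"
        by (intro mult_left_mono) auto
      then have "2 * real t + 1 \<le> real (Suc ?j) * ((4 * real t + 2) / real n)"
        using assms by (simp add: pos_le_divide_eq field_simps)
      then have "(2 * real t + 1) * ?B \<le> real (Suc ?j) * ((4 * real t + 2) / real n) * ?B"
        by (intro mult_right_mono) auto
      then show ?thesis by (simp add: mult_ac)
    qed
    finally show ?thesis by (rule mult_left_le_imp_le) simp
  qed (simp add: binomial_eq_0)
  moreover have "?B * (1 - 2 * real (Suc t) ^ 2 / real n)
      = ?B * (1 - 2 * real t ^ 2 / real n) - ?B * ((4 * real t + 2) / real n)"
    using assms by (simp add: field_simps power2_eq_square)
  ultimately show ?case using Suc by simp
qed simp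

section \<open>Pruning marked chains\<close>

text \<open>
  The elements of \<open>L\<close> stand for marked chains, with marks \<open>M c 0, \<dots>, M c (k - 1)\<close>. A bottleneck is
  a value \<open>y\<close> of the \<open>j\<close>-th mark at which an adversary can block the greedy embedding: every marked
  chain with this mark has another mark in one small set \<open>T\<close>. Pruning removes the marked chains with
  a bottleneck, which can create new bottlenecks among those that remain.
\<close>

definition bottleneck :: "nat \<Rightarrow> nat \<Rightarrow> ('x \<Rightarrow> nat \<Rightarrow> 'b) \<Rightarrow> 'x set \<Rightarrow> nat \<Rightarrow> 'b \<Rightarrow> bool" where
  "bottleneck k m M L j y \<longleftrightarrow> (\<exists>T. finite T \<and> card T \<le> m \<and>
     (\<forall>c\<in>L. M c j = y \<longrightarrow> (\<exists>j'<k. j' \<noteq> j \<and> M c j' \<in> T)))"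

definition prune :: "nat \<Rightarrow> nat \<Rightarrow> ('x \<Rightarrow> nat \<Rightarrow> 'b) \<Rightarrow> 'x set \<Rightarrow> 'x set" where
  "prune k m M L = {c \<in> L. \<forall>j<k. \<not> bottleneck k m M L j (M c j)}"

lemma prune_subset: "prune k m M L \<subseteq> L"
  by (auto simp: prune_def)

text \<open>
  The admissible images with \<open>i\<close> vertices to go are the marks of the chains that survive \<open>i\<close> rounds
  of pruning. A chain that survives one round more has no bottleneck among its marks, which is exactly
  the extension condition of the greedy embedding.
\<close>

lemma tree_poset_embeds_if_prune_nonempty:
  fixes M :: "'x \<Rightarrow> nat \<Rightarrow> 'b::order"
  assumes "finite A" "partial_order_on A r" "is_tree A (hasse_edges r)"
    and M: "\<And>c j. c \<in> L \<Longrightarrow> j < height r \<Longrightarrow> M c j \<in> F"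
    and le: "\<And>c i j. c \<in> L \<Longrightarrow> i \<le> j \<Longrightarrow> j < height r \<Longrightarrow> M c i \<le> M c j"
    and "(prune (height r) (card A) M ^^ card A) L \<noteq> {}"
  shows "subposet A r F (relation_of (\<le>) F)"
proof -
  let ?k = "height r" and ?m = "card A"
  let ?L = "\<lambda>i. (prune ?k ?m M ^^ i) L"
  have sub: "?L i \<subseteq> L" for i
  proof (induction i)
    case (Suc i)
    then show ?case
      unfolding funpow.simps comp_def using prune_subset by (rule subset_trans[rotated])
  qed simp
  show ?thesis
  proof (rule tree_poset_embeds[OF assms(1-3), where X = "\<lambda>i j. (\<lambda>c. M c j) ` ?L i"])
    fix j assume "j < ?k"
    show "(\<lambda>c. M c j) ` ?L 0 \<subseteq> F" using M \<open>j < ?k\<close> by auto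
    show "(\<lambda>c. M c j) ` ?L (Suc i) \<subseteq> (\<lambda>c. M c j) ` ?L i" for i
      unfolding funpow.simps comp_def by (intro image_mono prune_subset)
    show "(\<lambda>c. M c j) ` ?L ?m \<noteq> {}" using assms(6) by simp
  next
    fix i j j' y and T :: "'b set"
    assume *: "j < ?k" "j' < ?k" "j \<noteq> j'" "y \<in> (\<lambda>c. M c j) ` ?L (Suc i)" "finite T" "card T \<le> ?m"
    then have "\<not> bottleneck ?k ?m M (?L i) j y" by (auto simp: prune_def)
    then obtain c where c: "c \<in> ?L i" "M c j = y" "M c j' \<notin> T"
      using *(2,3,5,6) unfolding bottleneck_def by blast
    have "c \<in> L" using c(1) sub by blast
    then show "\<exists>z\<in>(\<lambda>c. M c j') ` ?L i. z \<notin> T \<and> (j' < j \<longrightarrow> z \<le> y) \<and> (j < j' \<longrightarrow> y \<le> z)"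
      using c * le[of c j j'] le[of c j' j] by (intro bexI[of _ "M c j'"]) auto
  qed
qed

text \<open>
  If \<open>Y\<close> is a bottleneck because of the set \<open>T\<close>, then every marked chain with \<open>j\<close>-th mark \<open>Y\<close>
  passes through \<open>Y\<close> and some other member of \<open>T\<close>, and a fraction of at most \<open>4 m / n\<close> of the chains
  through \<open>Y\<close> do so. Summing over all \<open>Y\<close> and the \<open>k\<close> values of \<open>j\<close> gives the bound.
\<close>

lemma card_pruned_le:
  fixes V :: "'v set"
  assumes "finite V" "G \<subseteq> Pow V"
    and mid: "\<And>Y. Y \<in> G \<Longrightarrow> card V < 4 * card Y \<and> 4 * card Y < 3 * card V"
    and L: "L \<subseteq> permutations_of_set V"
    and M: "\<And>xs j. xs \<in> L \<Longrightarrow> j < k \<Longrightarrow> M xs j \<in> chain_members G xs"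
    and inj: "\<And>xs i j. xs \<in> L \<Longrightarrow> i < k \<Longrightarrow> j < k \<Longrightarrow> i \<noteq> j \<Longrightarrow> M xs i \<noteq> M xs j"
  shows "card V * card (L - prune k m M L)
    \<le> 4 * k * m * (\<Sum>xs\<in>permutations_of_set V. card (chain_members G xs))"
proof -
  let ?n = "card V"
  let ?w = "\<lambda>Y. fact (card Y) * fact (?n - card Y) :: nat"
  define Bot where "Bot j = {Y \<in> G. bottleneck k m M L j Y}" for j
  have finG: "finite G" using finite_subset[OF assms(2)] assms(1) by simp
  have finL: "finite L" using finite_subset[OF L] by simp
  have Y_le: "?n * card {xs \<in> L. M xs j = Y} \<le> m * (4 * ?w Y)" if "j < k" "Y \<in> Bot j" for j Y
  proof -
    obtain T where T: "finite T" "card T \<le> m"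
      "\<And>xs. xs \<in> L \<Longrightarrow> M xs j = Y \<Longrightarrow> \<exists>j'<k. j' \<noteq> j \<and> M xs j' \<in> T"
      using \<open>Y \<in> Bot j\<close> unfolding Bot_def bottleneck_def by blast
    \<comment> \<open>Marks other than the \<open>j\<close>-th differ from \<open>Y\<close> and lie in \<open>G\<close>, so these members of \<open>T\<close> do the blocking.\<close>
    let ?T = "{Z \<in> T. Z \<in> G \<and> Z \<noteq> Y}"
    let ?S = "\<lambda>Z. {xs \<in> permutations_of_set V. on_chain Y xs \<and> on_chain Z xs}"
    have "{xs \<in> L. M xs j = Y} \<subseteq> (\<Union>Z\<in>?T. ?S Z)"
    proof
      fix xs assume xs: "xs \<in> {xs \<in> L. M xs j = Y}"
      then obtain j' where j': "j' < k" "j' \<noteq> j" "M xs j' \<in> T" using T(3) by blast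
      have "M xs j' \<in> ?T" using M[of xs j'] inj[of xs j' j] xs j' that(1) by (auto simp: chain_members_def)
      moreover have "xs \<in> ?S (M xs j')"
        using M[of xs j'] M[of xs j] xs j' that(1) L by (auto simp: chain_members_def)
      ultimately show "xs \<in> (\<Union>Z\<in>?T. ?S Z)" by blast
    qed
    then have "card {xs \<in> L. M xs j = Y} \<le> card (\<Union>Z\<in>?T. ?S Z)"
      by (rule card_mono[rotated]) (use T(1) in auto)
    also have "\<dots> \<le> (\<Sum>Z\<in>?T. card (?S Z))" by (rule card_UN_le) (use T(1) in auto)
    finally have "?n * card {xs \<in> L. M xs j = Y} \<le> (\<Sum>Z\<in>?T. ?n * card (?S Z))"
      unfolding sum_distrib_left[symmetric] by (rule mult_le_mono2)
    also have "\<dots> \<le> (\<Sum>Z\<in>?T. 4 * ?w Y)"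
    proof (rule sum_mono)
      fix Z assume Z: "Z \<in> ?T"
      have YG: "Y \<in> G" using that(2) by (simp add: Bot_def)
      have "Z \<in> G" using Z by simp
      then have "Z \<noteq> {}" "Z \<noteq> V" using mid[of Z] by auto
      moreover have "Y \<subseteq> V" "Z \<subseteq> V" "Z \<noteq> Y" using Z YG assms(2) by auto
      ultimately show "?n * card (?S Z) \<le> 4 * ?w Y"
        using mid[OF YG] by (intro card_permutations_through_two_le[OF assms(1)]) simp_all
    qed
    also have "\<dots> = card ?T * (4 * ?w Y)" by simp
    also have "\<dots> \<le> m * (4 * ?w Y)"
    proof (rule mult_le_mono1)
      have "card ?T \<le> card T" using T(1) by (intro card_mono) auto
      then show "card ?T \<le> m" using T(2) by simp
    qed
    finally show ?thesis .
  qed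
  have "L - prune k m M L \<subseteq> (\<Union>j<k. \<Union>Y\<in>Bot j. {xs \<in> L. M xs j = Y})"
  proof
    fix xs assume xs: "xs \<in> L - prune k m M L"
    then obtain j where j: "j < k" "bottleneck k m M L j (M xs j)" by (auto simp: prune_def)
    then have "M xs j \<in> Bot j" using M[of xs j] xs by (simp add: Bot_def chain_members_def)
    then show "xs \<in> (\<Union>j<k. \<Union>Y\<in>Bot j. {xs \<in> L. M xs j = Y})" using xs j(1) by blast
  qed
  then have "card (L - prune k m M L) \<le> card (\<Union>j<k. \<Union>Y\<in>Bot j. {xs \<in> L. M xs j = Y})"
    by (rule card_mono[rotated]) (use finL finG in \<open>auto simp: Bot_def\<close>)
  also have "\<dots> \<le> (\<Sum>j<k. card (\<Union>Y\<in>Bot j. {xs \<in> L. M xs j = Y}))"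
    by (rule card_UN_le) auto
  also have "\<dots> \<le> (\<Sum>j<k. \<Sum>Y\<in>Bot j. card {xs \<in> L. M xs j = Y})"
    by (rule sum_mono, rule card_UN_le) (use finG in \<open>auto simp: Bot_def\<close>)
  finally have "?n * card (L - prune k m M L) \<le> (\<Sum>j<k. \<Sum>Y\<in>Bot j. ?n * card {xs \<in> L. M xs j = Y})"
    unfolding sum_distrib_left[symmetric] by (rule mult_le_mono2)
  also have "\<dots> \<le> (\<Sum>j<k. \<Sum>Y\<in>Bot j. m * (4 * ?w Y))"
    by (intro sum_mono Y_le) auto
  also have "\<dots> \<le> (\<Sum>j<k. \<Sum>Y\<in>G. m * (4 * ?w Y))"
    by (intro sum_mono sum_mono2) (use finG in \<open>auto simp: Bot_def\<close>)
  also have "\<dots> = 4 * k * m * (\<Sum>Y\<in>G. ?w Y)"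
    by (simp add: sum_distrib_left mult_ac)
  finally show ?thesis unfolding sum_card_chain_members[OF assms(1,2)] .
qed

text \<open>
  Otherwise a linear extension of the poset would fit on the chain.
\<close>

lemma card_chain_members_le:
  assumes "finite A" "partial_order_on A r" "poset_free A r F" "finite F"
  shows "card (chain_members F xs) \<le> card A"
proof (rule ccontr)
  assume "\<not> ?thesis"
  then have "subposet A r (chain_members F xs) (relation_of (\<le>) (chain_members F xs))"
  proof (intro embeds_in_long_chain[OF assms(1), where \<phi> = "rank r"])
    show "finite (chain_members F xs)" using assms(4) by (simp add: chain_members_def)
    show "Y \<le> Z \<or> Z \<le> Y" if "Y \<in> chain_members F xs" "Z \<in> chain_members F xs" for Y Z
      using that on_chain_comparable[of Y xs Z] by (simp add: chain_members_def)
  qed (use rank_strict_mono[OF assms(1,2)] in auto)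
  then have "subposet A r F (relation_of (\<le>) F)"
    by (rule subposet_mono) (simp add: chain_members_def)
  then show False using assms(3) by (simp add: poset_free_def)
qed

lemma sum_card_chain_members_le:
  assumes "finite V" "finite A" "partial_order_on A r" "poset_free A r F" "finite F"
  shows "(\<Sum>xs\<in>permutations_of_set V. card (chain_members F xs)) \<le> card A * fact (card V)"
proof -
  have "(\<Sum>xs\<in>permutations_of_set V. card (chain_members F xs)) \<le> (\<Sum>xs\<in>permutations_of_set V. card A)"
    using card_chain_members_le[OF assms(2-5)] by (intro sum_mono)
  then show ?thesis using assms(1) by (simp add: mult.commute)
qed

text \<open>
  If the bound failed, \<open>card A\<close> rounds of pruning could not exhaust the rich chains, each of them
  removing at most the number given by \<open>card_pruned_le\<close>.
\<close>

lemma card_rich_permutations_le: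
  fixes V :: "'v set"
  assumes "finite A" "partial_order_on A r" "is_tree A (hasse_edges r)"
    and "finite V" "G \<subseteq> Pow V" "poset_free A r G"
    and mid: "\<And>Y. Y \<in> G \<Longrightarrow> card V < 4 * card Y \<and> 4 * card Y < 3 * card V"
  shows "card V * card {xs \<in> permutations_of_set V. height r \<le> card (chain_members G xs)}
    \<le> 4 * height r * card A ^ 3 * fact (card V)"
proof -
  let ?n = "card V" and ?k = "height r" and ?m = "card A"
  define L where "L = {xs \<in> permutations_of_set V. ?k \<le> card (chain_members G xs)}"
  have finG: "finite G" using finite_subset[OF assms(5)] assms(4) by simp
  have finL: "finite L" by (simp add: L_def)
  have "\<exists>g. inj_on g {..<?k} \<and> g ` {..<?k} \<subseteq> chain_members G xs \<and>
      (\<forall>j<?k. \<forall>i\<le>j. g i \<subseteq> g j)" if "xs \<in> L" for xs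
  proof -
    have "subposet {..<?k} {(i, j). i \<le> j} (chain_members G xs) (relation_of (\<le>) (chain_members G xs))"
    proof (rule embeds_in_long_chain[where \<phi> = id])
      show "finite (chain_members G xs)" using finG by (simp add: chain_members_def)
      show "Y \<le> Z \<or> Z \<le> Y" if "Y \<in> chain_members G xs" "Z \<in> chain_members G xs" for Y Z
        using that on_chain_comparable[of Y xs Z] by (simp add: chain_members_def)
      show "card {..<?k} \<le> card (chain_members G xs)" using that by (simp add: L_def)
    qed auto
    then obtain g where "inj_on g {..<?k}" "g ` {..<?k} \<subseteq> chain_members G xs"
      "\<forall>i\<in>{..<?k}. \<forall>j\<in>{..<?k}. (i, j) \<in> {(i, j). i \<le> j} \<longrightarrow>
         (g i, g j) \<in> relation_of (\<le>) (chain_members G xs)"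
      unfolding subposet_def by blast
    then show ?thesis by (intro exI[of _ g]) (auto simp: relation_of_def)
  qed
  then obtain M where M: "\<And>xs. xs \<in> L \<Longrightarrow> inj_on (M xs) {..<?k}"
    "\<And>xs. xs \<in> L \<Longrightarrow> M xs ` {..<?k} \<subseteq> chain_members G xs"
    "\<And>xs i j. xs \<in> L \<Longrightarrow> j < ?k \<Longrightarrow> i \<le> j \<Longrightarrow> M xs i \<subseteq> M xs j"
    by metis
  let ?L = "\<lambda>i. (prune ?k ?m M ^^ i) L"
  let ?X = "\<Sum>xs\<in>permutations_of_set V. card (chain_members G xs)"
  have sub: "?L i \<subseteq> L" for i
  proof (induction i)
    case (Suc i)
    then show ?case
      unfolding funpow.simps comp_def using prune_subset by (rule subset_trans[rotated])
  qed simp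
  \<comment> \<open>Telescoping the loss over \<open>i\<close> rounds.\<close>
  have loss: "?n * card L \<le> ?n * card (?L i) + i * (4 * ?k * ?m * ?X)" for i
  proof (induction i)
    case (Suc i)
    have fin: "finite (?L i)" using sub finL finite_subset by blast
    have "?n * card (?L i - ?L (Suc i)) \<le> 4 * ?k * ?m * ?X"
      unfolding funpow.simps comp_def
    proof (rule card_pruned_le[OF assms(4,5) mid])
      show "?L i \<subseteq> permutations_of_set V" using sub by (auto simp: L_def)
      show "M xs j \<in> chain_members G xs" if "xs \<in> ?L i" "j < ?k" for xs j
        using M(2)[of xs] that sub by blast
      show "M xs j \<noteq> M xs j'" if "xs \<in> ?L i" "j < ?k" "j' < ?k" "j \<noteq> j'" for xs j j'
        using M(1)[of xs] that sub by (auto simp: inj_on_def)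
    qed
    moreover have "card (?L i) = card (?L (Suc i)) + card (?L i - ?L (Suc i))"
      using prune_subset[of ?k ?m M "?L i"] fin
      by (simp add: card_Diff_subset card_mono finite_subset)
    ultimately show ?case using Suc by (simp add: algebra_simps)
  qed simp
  have "?L ?m = {}"
  proof (rule ccontr)
    assume ne: "?L ?m \<noteq> {}"
    have "subposet A r G (relation_of (\<le>) G)"
    proof (rule tree_poset_embeds_if_prune_nonempty[OF assms(1-3) _ _ ne])
      show "M c j \<in> G" if "c \<in> L" "j < ?k" for c j
        using M(2)[OF that(1)] that(2) by (auto simp: chain_members_def)
    qed (rule M(3))
    then show False using assms(6) by (simp add: poset_free_def)
  qed
  then have "?n * card L \<le> ?m * (4 * ?k * ?m * ?X)" using loss[of ?m] by simp
  also have "\<dots> \<le> ?m * (4 * ?k * ?m * (?m * fact ?n))"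
    using sum_card_chain_members_le[OF assms(4,1,2,6) finG] by (intro mult_le_mono2)
  also have "\<dots> = 4 * ?k * ?m ^ 3 * fact ?n" by (simp add: power3_eq_cube)
  finally show ?thesis unfolding L_def .
qed

section \<open>Extremal families\<close>

text \<open>
  \<open>G\<close> collects the sets of \<open>F\<close> of medium size and \<open>H\<close> the others. On average, a full chain has at
  most \<open>k - 1\<close> members of \<open>G\<close>, plus \<open>m\<close> times the proportion of rich chains. It has at most \<open>m\<close>
  members of \<open>H\<close>, but each of these weighs at least \<open>n / 12\<close> times as much as a set in
  the middle.
\<close>

lemma card_poset_free_le:
  fixes V :: "'v set"
  assumes "finite A" "partial_order_on A r" "is_tree A (hasse_edges r)"
    and "finite V" "V \<noteq> {}" "F \<subseteq> Pow V" "poset_free A r F"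
  defines "n \<equiv> card V" and "k \<equiv> height r" and "m \<equiv> card A"
  shows "real (card F) \<le> (real k - 1 + real (4 * k * m ^ 4 + 12 * m) / real n) * real (n choose (n div 2))"
proof -
  let ?B = "real (n choose (n div 2))"
  define G where "G = {Y \<in> F. n < 4 * card Y \<and> 4 * card Y < 3 * n}"
  define H where "H = F - G"
  let ?X = "\<lambda>F'. \<Sum>xs\<in>permutations_of_set V. card (chain_members F' xs)"
  have n: "0 < n" using assms(4,5) by (simp add: n_def card_gt_0_iff)
  have sub: "G \<subseteq> Pow V" "H \<subseteq> Pow V" using assms(6) by (auto simp: G_def H_def)
  have fin: "finite G" "finite H"
    using finite_subset[OF sub(1)] finite_subset[OF sub(2)] assms(4) by auto
  have free: "poset_free A r G" "poset_free A r H"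
    using assms(7) subposet_mono unfolding poset_free_def G_def H_def by blast+
  have k: "1 \<le> k" using tree_height_pos[OF assms(1-3)] by (simp add: k_def)

  define R where "R = {xs \<in> permutations_of_set V. k \<le> card (chain_members G xs)}"
  have R: "n * card R \<le> 4 * k * m ^ 3 * fact n"
    unfolding R_def n_def k_def m_def
    by (rule card_rich_permutations_le[OF assms(1-4) sub(1) free(1)]) (auto simp: G_def n_def)
  have "?X G \<le> (\<Sum>xs\<in>permutations_of_set V. (k - 1) + (if xs \<in> R then m else 0))"
  proof (rule sum_mono)
    fix xs assume "xs \<in> permutations_of_set V"
    then show "card (chain_members G xs) \<le> (k - 1) + (if xs \<in> R then m else 0)"
      using card_chain_members_le[OF assms(1,2) free(1) fin(1), of xs] unfolding R_def m_def by auto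
  qed
  also have "\<dots> = (k - 1) * fact n + m * card R"
  proof -
    have "permutations_of_set V \<inter> R = R" by (auto simp: R_def)
    then show ?thesis using assms(4)
      by (simp add: sum.distrib n_def mult.commute flip: sum.inter_restrict)
  qed
  finally have "real (?X G) \<le> real ((k - 1) * fact n + m * card R)" by (simp only: of_nat_le_iff)
  then have X: "real (?X G) \<le> (real k - 1) * fact n + real m * real (card R)"
    using k by (simp add: of_nat_diff)
  have "real (card R) \<le> real (4 * k * m ^ 3) / real n * fact n"
  proof -
    have "real (n * card R) \<le> real (4 * k * m ^ 3 * fact n)" using R by (simp only: of_nat_le_iff)
    then show ?thesis using n by (simp add: field_simps)
  qed
  then have "real m * real (card R) \<le> real m * (real (4 * k * m ^ 3) / real n * fact n)"
    by (intro mult_left_mono) auto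
  with X have X': "real (?X G) \<le> (real k - 1 + real (4 * k * m ^ 4) / real n) * fact n"
    by (simp add: algebra_simps power4_eq_xxxx power3_eq_cube)
  have "real (card G) * fact n \<le> ?B * real (?X G)"
    unfolding n_def by (rule card_mult_fact_le_sum_chain_members[OF assms(4) sub(1)]) (simp add: binomial_maximum)
  also have "\<dots> \<le> ?B * ((real k - 1 + real (4 * k * m ^ 4) / real n) * fact n)"
    using X' by (intro mult_left_mono) auto
  also have "\<dots> = (real k - 1 + real (4 * k * m ^ 4) / real n) * ?B * fact n"
    by (simp only: mult_ac)
  finally have G: "real (card G) \<le> (real k - 1 + real (4 * k * m ^ 4) / real n) * ?B"
    by (rule mult_right_le_imp_le) simp

  have "real (card H) * fact n \<le> (12 * ?B / real n) * real (?X H)"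
    unfolding n_def
  proof (rule card_mult_fact_le_sum_chain_members[OF assms(4) sub(2)], fold n_def)
    fix Y assume "Y \<in> H"
    then have "4 * card Y \<le> n \<or> 3 * n \<le> 4 * card Y" by (auto simp: H_def G_def)
    then have "real (n * (n choose card Y)) \<le> real (12 * (n choose (n div 2)))"
      using binomial_outer_le by (simp only: of_nat_le_iff)
    then show "real (n choose card Y) \<le> 12 * ?B / real n"
      using n by (simp add: field_simps)
  qed
  also have "\<dots> \<le> (12 * ?B / real n) * (real m * fact n)"
  proof (rule mult_left_mono)
    have "real (?X H) \<le> real (card A * fact (card V))"
      using sum_card_chain_members_le[OF assms(4,1,2) free(2) fin(2)] by (simp only: of_nat_le_iff)
    then show "real (?X H) \<le> real m * fact n" by (simp add: m_def n_def)
  qed simp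
  also have "\<dots> = real (12 * m) / real n * ?B * fact n" by simp
  finally have H: "real (card H) \<le> real (12 * m) / real n * ?B"
    by (rule mult_right_le_imp_le) simp

  have "card F = card G + card H"
  proof -
    have "F = G \<union> H" "G \<inter> H = {}" by (auto simp: G_def H_def)
    then show ?thesis using card_Un_disjoint[OF fin(1,2)] by simp
  qed
  then have "real (card F) \<le> (real k - 1 + real (4 * k * m ^ 4) / real n) * ?B + real (12 * m) / real n * ?B"
    using G H by simp
  also have "\<dots> = (real k - 1 + real (4 * k * m ^ 4 + 12 * m) / real n) * ?B"
    by (simp add: ring_distribs add_divide_distrib)
  finally show ?thesis .
qed

lemma middle_layers_poset_free:
  assumes "finite A" "partial_order_on A r" "t < height r" "finite V"
  shows "poset_free A r {Y \<in> Pow V. s \<le> card Y \<and> card Y < s + t}"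
proof (rule poset_free_if_few_levels[OF assms(1,2), where lev = card and Z = "{s..<s + t}"])
  fix Y Z assume *: "Y \<in> {Y \<in> Pow V. s \<le> card Y \<and> card Y < s + t}"
    "Z \<in> {Y \<in> Pow V. s \<le> card Y \<and> card Y < s + t}" "Y < Z"
  then have "finite Z" using finite_subset[OF _ assms(4), of Z] by simp
  then show "card Y \<noteq> card Z" using *(3) psubset_card_mono[of Z Y] by simp
qed (use assms(3) in auto)

lemma card_layers:
  assumes "finite V"
  shows "card {Y \<in> Pow V. s \<le> card Y \<and> card Y < s + t} = (\<Sum>i<t. card V choose (s + i))"
proof -
  have "{Y \<in> Pow V. s \<le> card Y \<and> card Y < s + t} = (\<Union>i<t. {Y. Y \<subseteq> V \<and> card Y = s + i})"
    (is "?L = ?R")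
  proof (intro equalityI subsetI)
    fix Y assume Y: "Y \<in> ?L"
    then have "card Y - s \<in> {..<t}" "Y \<in> {Y. Y \<subseteq> V \<and> card Y = s + (card Y - s)}" by auto
    then show "Y \<in> ?R" by (intro UN_I[of "card Y - s"]) simp_all
  next
    fix Y assume "Y \<in> ?R"
    then show "Y \<in> ?L" by auto
  qed
  also have "card \<dots> = (\<Sum>i<t. card {Y. Y \<subseteq> V \<and> card Y = s + i})"
    by (rule card_UN_disjoint) (use assms in auto)
  also have "\<dots> = (\<Sum>i<t. card V choose (s + i))"
    using n_subsets[OF assms] by simp
  finally show ?thesis .
qed

lemma
  assumes "A \<noteq> {}"
  shows ex_poset_attained: "\<exists>F \<subseteq> Pow {1..n}. poset_free A r F \<and> card F = ex_poset A r n"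
    and card_le_ex_poset: "F \<subseteq> Pow {1..n} \<Longrightarrow> poset_free A r F \<Longrightarrow> card F \<le> ex_poset A r n"
proof -
  let ?C = "{F :: nat set set. F \<subseteq> Pow {1..n} \<and> poset_free A r F}"
  have fin: "finite ?C" by (rule finite_subset[of _ "Pow (Pow {1..n})"]) auto
  have "poset_free A r ({} :: nat set set)" using assms by (auto simp: poset_free_def subposet_def)
  then have "?C \<noteq> {}" by blast
  then have "ex_poset A r n \<in> card ` ?C" unfolding ex_poset_def using fin by (intro Max_in) auto
  then obtain F\<^sub>0 where "F\<^sub>0 \<in> ?C" "ex_poset A r n = card F\<^sub>0" by (rule imageE)
  then show "\<exists>F \<subseteq> Pow {1..n}. poset_free A r F \<and> card F = ex_poset A r n"
    by (intro exI[of _ F\<^sub>0]) simp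
  show "card F \<le> ex_poset A r n" if "F \<subseteq> Pow {1..n}" "poset_free A r F"
    unfolding ex_poset_def using fin that by (intro Max_ge) auto
qed

text \<open>
  For height one the main term vanishes, so that no error is permitted. All vertices have rank \<open>0\<close>,
  the extension condition of the greedy embedding is vacuous, and any nonempty family contains the
  poset.
\<close>

lemma ex_poset_eq_0:
  assumes "finite A" "partial_order_on A r" "is_tree A (hasse_edges r)" "height r = 1"
  shows "ex_poset A r n = 0"
proof -
  have "A \<noteq> {}" using assms(3) by (auto simp: is_tree_def graph_connected_def)
  then obtain F where F: "poset_free A r F" "card F = ex_poset A r n" "F \<subseteq> Pow {1..n}"
    using ex_poset_attained by metis
  have "F = {}"
  proof (rule ccontr)
    assume "F \<noteq> {}"
    then have "subposet A r F (relation_of (\<le>) F)"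
      by (intro tree_poset_embeds[OF assms(1-3), where X = "\<lambda>_ _. F"]) (use assms(4) in auto)
    then show False using F(1) by (simp add: poset_free_def)
  qed
  then show ?thesis using F(2) by simp
qed

text \<open>
  The \<open>t\<close> layers from the middle upwards form a family of the required size.
\<close>

lemma ex_poset_ge:
  assumes "finite A" "partial_order_on A r" "A \<noteq> {}" "t < height r" "0 < n"
  shows "(1 - 2 * real t ^ 2 / real n) * (real t * real (n choose (n div 2))) \<le> real (ex_poset A r n)"
proof -
  let ?B = "real (n choose (n div 2))"
  have "(1 - 2 * real t ^ 2 / real n) * (real t * ?B) = (\<Sum>i<t. ?B * (1 - 2 * real t ^ 2 / real n))"
    by simp
  also have "\<dots> \<le> (\<Sum>i<t. real (n choose (n div 2 + i)))"
  proof (rule sum_mono)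
    fix i assume "i \<in> {..<t}"
    then have "real i ^ 2 \<le> real t ^ 2" by (intro power_mono) auto
    then have "?B * (1 - 2 * real t ^ 2 / real n) \<le> ?B * (1 - 2 * real i ^ 2 / real n)"
      by (intro mult_left_mono diff_left_mono divide_right_mono) auto
    also have "\<dots> \<le> real (n choose (n div 2 + i))" using binomial_near_middle_ge[OF assms(5)] .
    finally show "?B * (1 - 2 * real t ^ 2 / real n) \<le> real (n choose (n div 2 + i))" .
  qed
  also have "\<dots> = real (card {Y \<in> Pow {1..n}. n div 2 \<le> card Y \<and> card Y < n div 2 + t})"
    using card_layers[of "{1..n}" "n div 2" t] by simp
  also have "\<dots> \<le> real (ex_poset A r n)"
    unfolding of_nat_le_iff
    by (rule card_le_ex_poset[OF assms(3) _ middle_layers_poset_free[OF assms(1,2,4)]]) auto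
  finally show ?thesis .
qed

lemma ex_poset_asymptotics:
  assumes "finite A" "partial_order_on A r" "is_tree A (hasse_edges r)"
  shows "\<exists>\<epsilon> :: nat \<Rightarrow> real. \<epsilon> \<in> O(\<lambda>n. 1 / real n) \<and>
    (\<forall>n. real (ex_poset A r n) = (real (height r) - 1) * real (n choose (n div 2)) * (1 + \<epsilon> n))"
proof (cases "height r = 1")
  case True
  then show ?thesis using ex_poset_eq_0[OF assms True] by (intro exI[of _ "\<lambda>_. 0"]) auto
next
  case False
  let ?k = "height r" and ?m = "card A"
  let ?B = "\<lambda>n. real (n choose (n div 2))"
  have ne: "A \<noteq> {}" using assms(3) by (auto simp: is_tree_def graph_connected_def)
  have k: "2 \<le> ?k" using tree_height_pos[OF assms] False by simp
  define t where "t = real ?k - 1"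
  have t: "1 \<le> t" "real (?k - 1) = t" using k by (auto simp: t_def of_nat_diff)
  define a where "a = real (4 * ?k * ?m ^ 4 + 12 * ?m)"
  define \<epsilon> where "\<epsilon> n = real (ex_poset A r n) / (t * ?B n) - 1" for n
  have B: "0 < ?B n" for n by simp
  have "norm (\<epsilon> n) \<le> (a + 2 * t ^ 2) * norm (1 / real n)" if n: "0 < n" for n
  proof -
    have tB: "0 < t * ?B n" using B[of n] t(1) by simp
    obtain F where F: "F \<subseteq> Pow {1..n}" "poset_free A r F" "card F = ex_poset A r n"
      using ex_poset_attained[OF ne] by metis
    have "real (ex_poset A r n) \<le> (t + a / real n) * ?B n"
      using card_poset_free_le[OF assms _ _ F(1,2)] n F(3) by (simp add: a_def t_def)
    also have "\<dots> \<le> (t + t * (a / real n)) * ?B n"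
    proof (intro mult_right_mono add_left_mono)
      have "0 \<le> a / real n" by (simp add: a_def)
      then show "a / real n \<le> t * (a / real n)" using mult_right_mono[OF t(1)] by fastforce
    qed simp
    finally have "\<epsilon> n \<le> a / real n"
      using tB unfolding \<epsilon>_def by (simp add: pos_divide_le_eq algebra_simps)
    moreover have "(1 - 2 * t ^ 2 / real n) * (t * ?B n) \<le> real (ex_poset A r n)"
      using ex_poset_ge[OF assms(1,2) ne _ n, of "?k - 1"] k t(2) by simp
    then have "1 - 2 * t ^ 2 / real n \<le> real (ex_poset A r n) / (t * ?B n)"
      by (subst pos_le_divide_eq[OF tB])
    then have "- (2 * t ^ 2 / real n) \<le> \<epsilon> n" by (simp add: \<epsilon>_def)
    moreover have "0 \<le> a / real n" "0 \<le> 2 * t ^ 2 / real n" by (auto simp: a_def)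
    ultimately have "\<bar>\<epsilon> n\<bar> \<le> a / real n + 2 * t ^ 2 / real n" by linarith
    then show ?thesis by (simp add: add_divide_distrib)
  qed
  then have "\<epsilon> \<in> O(\<lambda>n. 1 / real n)"
    by (intro bigoI[of _ "a + 2 * t ^ 2"] eventually_mono[OF eventually_gt_at_top[of 0]])
  moreover have "real (ex_poset A r n) = (real ?k - 1) * ?B n * (1 + \<epsilon> n)" for n
  proof -
    have "t * ?B n \<noteq> 0" using B[of n] t(1) by simp
    then show ?thesis unfolding \<epsilon>_def t_def[symmetric] by simp
  qed
  ultimately show ?thesis by blast
qed

theorem theorem1:
  fixes A :: "'a set" and r :: "'a rel"
  assumes "finite A"
    and "partial_order_on A r"
    and "is_tree A (hasse_edges r)"
  shows "(\<exists>\<epsilon> :: nat \<Rightarrow> real. \<epsilon> \<in> O(\<lambda>n. 1 / real n) \<and>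
            (\<forall>n. real (ex_poset A r n) =
                 (real (height r) - 1) * real (n choose (n div 2)) * (1 + \<epsilon> n)))
         \<and> max_levels A r = enat (height r - 1)"
  using ex_poset_asymptotics[OF assms] max_levels_tree[OF assms] by (rule conjI)

end
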